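(* Fix an integer $d\ge 2$ and $k\in\mathbb{N}$. The function $p\mapsto q_c(p,k)$ is continuous on $[0,1]$ and strictly decreasing on $[0,d^{-1}]$.
   Context: Let $[d]=\{1,\dots,d\}$ and $[d]_\star=\bigcup_{n\ge 0}[d]^n$ (finite sequences, $[d]^0=\{o\}$ with $o$ the empty sequence), with concatenation $u\cdot v$. For $k\in\mathbb{N}$, $\mathbb{T}_{d,k}$ is the oriented graph with vertex set $[d]_\star$ and oriented edges $\langle u,u\cdot a\rangle$ for $u\in[d]_\star$, $a\in[d]$ ("short edges") and $\langle u,u\cdot r\rangle$ for $u\in[d]_\star$, $r\in[d]^k$ ("long edges"). Under $\mathbb{P}_{p,q}$, independently, each short edge is open with probability $p$ and each long edge is open with probability $q$. The event $o\leadsto\infty$ means that there are infinitely many vertices $v$ reachable from $o$ by a path $o=u^0,u^1,\dots,u^n=v$ with each oriented edge $\langle u^j,u^{j+1}\rangle$ open. Let $\mathcal{P}_k=\{(p,q)\in[0,1]^2:\mathbb{P}_{p,q}(o\leadsto\infty)>0\}$ (computed on $\mathbb{T}_{d,k}$) and $q_c(p,k)=\inf\{q:(p,q)\in\mathcal{P}_k\}$. *)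

theory Defs
  imports "HOL-Probability.Probability"
begin

text \<open>Vertices of the tree are finite sequences over [d] = {1..d}, represented as nat lists.\<close>

definition word :: "nat \<Rightarrow> nat list \<Rightarrow> bool" where
  "word d u \<longleftrightarrow> set u \<subseteq> {1..d}"

text \<open>Oriented edges: short edges <u, u.a> and long edges <u, u.r>, with their own identities
  (so for k = 1 a long edge is a distinct edge parallel to a short one).\<close>

datatype edge = Short "nat list" nat | Long "nat list" "nat list"

definition edges :: "nat \<Rightarrow> nat \<Rightarrow> edge set" where
  "edges d k = {Short u a | u a. word d u \<and> a \<in> {1..d}}
             \<union> {Long u r | u r. word d u \<and> word d r \<and> length r = k}"

definition edge_prob :: "real \<Rightarrow> real \<Rightarrow> edge \<Rightarrow> real" where
  "edge_prob p q e = (case e of Short _ _ \<Rightarrow> p | Long _ _ \<Rightarrow> q)"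

definition perc :: "nat \<Rightarrow> nat \<Rightarrow> real \<Rightarrow> real \<Rightarrow> (edge \<Rightarrow> bool) measure" where
  "perc d k p q = (\<Pi>\<^sub>M e\<in>edges d k. measure_pmf (bernoulli_pmf (edge_prob p q e)))"

definition open_step :: "nat \<Rightarrow> nat \<Rightarrow> (edge \<Rightarrow> bool) \<Rightarrow> nat list \<Rightarrow> nat list \<Rightarrow> bool" where
  "open_step d k w u v \<longleftrightarrow> word d u \<and>
     ((\<exists>a\<in>{1..d}. v = u @ [a] \<and> w (Short u a)) \<or>
      (\<exists>r. word d r \<and> length r = k \<and> v = u @ r \<and> w (Long u r)))"

definition percolates :: "nat \<Rightarrow> nat \<Rightarrow> (edge \<Rightarrow> bool) \<Rightarrow> bool" where
  "percolates d k w \<longleftrightarrow> infinite {v. (open_step d k w)\<^sup>*\<^sup>* [] v}"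

definition theta :: "nat \<Rightarrow> nat \<Rightarrow> real \<Rightarrow> real \<Rightarrow> real" where
  "theta d k p q = measure (perc d k p q) {w \<in> space (perc d k p q). percolates d k w}"

definition perc_region :: "nat \<Rightarrow> nat \<Rightarrow> (real \<times> real) set" where
  "perc_region d k = {(p, q). p \<in> {0..1} \<and> q \<in> {0..1} \<and> theta d k p q > 0}"

definition q_c :: "nat \<Rightarrow> nat \<Rightarrow> real \<Rightarrow> real" where
  "q_c d k p = Inf {q. (p, q) \<in> perc_region d k}"

end

theory Submission
  imports Defs
begin

text \<open>A vertex at level \<open>n\<close> is reached with a probability \<open>\<pi>_n(p, q)\<close> that only involves the edges along
  its ray, i.e. a one-dimensional model with hops of length \<open>1\<close> and \<open>k\<close>. If \<open>d^n \<pi>_n > 1\<close> for some \<open>n\<close>,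
  a branching process embedded in the tree survives; if \<open>\<Sum>n. d^n \<pi>_n < \<infinity>\<close>, Borel-Cantelli excludes
  percolation. In the ray model every edge is pivotal with probability at least \<open>c \<pi>_n\<close>, by a local
  modification, so raising \<open>p\<close> (or \<open>q\<close>, when \<open>p > 0\<close>) multiplies \<open>\<pi>_n\<close> by a factor exponential in \<open>n\<close>:
  this separates the two regimes and gives strict monotonicity. Conversely thinning gives
  \<open>\<pi>_n(t p, q), \<pi>_n(p, t q) \<ge> t^n \<pi>_n(p, q)\<close>, hence continuity.\<close>

subsection \<open>Finite products of Bernoulli variables\<close>

text \<open>The two criteria leave a gap: failing the first only gives d^n \<pi>_n \<le> 1 for all
  n, which is not summable. The exponential comparison closes it, since for 0 < p < 1 any decrease
  of q turns boundedness into geometric decay. For strict monotonicity the gain is traded: what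
  lowering p wins pays for thinning q down from a slightly larger value. The local modification has
  to reconnect a path around an arbitrary edge, which takes open short edges. At p = 0 and k \<ge> 2
  only multiples of k are ever reached and the method fails. That endpoint is governed by the
  explicit bounds (1 - d p) / d^k \<le> q_c \<le> 1 / d^k, which meet there; the lower one also
  makes q_c positive on [0, 1/d), leaving room to raise q by a factor. The estimates concern
  finitely many edges at a time, so expectations are finite weighted sums, treated by conditioning
  on one edge; the infinite product measure enters only when level events are related to
  \<open>theta\<close>.\<close>

definition depends_on :: "'e set \<Rightarrow> (('e \<Rightarrow> bool) \<Rightarrow> 'a) \<Rightarrow> bool" where
  "depends_on A f \<longleftrightarrow> (\<forall>w w'. (\<forall>e\<in>A. w e = w' e) \<longrightarrow> f w = f w')"

text \<open>Expectation over independent Bernoulli(\<open>x e\<close>) variables with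
  \<open>S\<close> the set of open edges; coordinates outside \<open>U\<close> are frozen to
  \<open>False\<close>. The weights are arbitrary reals, so identities are purely algebraic and
  [0,1] enters only in inequalities.\<close>

definition expect :: "'e set \<Rightarrow> ('e \<Rightarrow> real) \<Rightarrow> (('e \<Rightarrow> bool) \<Rightarrow> real) \<Rightarrow> real" where
  "expect U x f = (\<Sum>S\<in>Pow U. (\<Prod>e\<in>U. if e \<in> S then x e else 1 - x e) * f (\<lambda>e. e \<in> S))"

lemma depends_onI:
  assumes "\<And>w w'. (\<And>e. e \<in> A \<Longrightarrow> w e = w' e) \<Longrightarrow> f w = f w'"
  shows "depends_on A f"
  unfolding depends_on_def by (intro allI impI assms) blast

lemma depends_onD:
  assumes "depends_on A f" "\<And>e. e \<in> A \<Longrightarrow> w e = w' e"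
  shows "f w = f w'"
  using assms(1)[unfolded depends_on_def, rule_format, OF assms(2)] .

lemma depends_on_mono:
  assumes "depends_on A f" "A \<subseteq> B"
  shows "depends_on B f"
proof (rule depends_onI)
  fix w w' :: "'a \<Rightarrow> bool"
  assume "\<And>e. e \<in> B \<Longrightarrow> w e = w' e"
  thus "f w = f w'" using assms(2) by (intro depends_onD[OF assms(1)]) blast
qed

lemma depends_on_compose:
  assumes "depends_on A f"
  shows "depends_on A (\<lambda>w. g (f w))"
  by (rule depends_onI, rule arg_cong[where f = g], rule depends_onD[OF assms])

lemma depends_on_upd:
  assumes "depends_on A f"
  shows "depends_on A (\<lambda>w. f (w(e := b)))"
  by (rule depends_onI, rule depends_onD[OF assms]) simp

lemma depends_on_upd_notin:
  assumes "depends_on A f" "e \<notin> A"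
  shows "f (w(e := b)) = f w"
  by (rule depends_onD[OF assms(1)]) (use assms(2) in auto)

lemma expect_empty [simp]: "expect {} x f = f (\<lambda>_. False)"
  by (simp add: expect_def)

text \<open>Splitting the subsets of \<open>insert e U\<close> by membership of \<open>e\<close> is
  conditioning on the state of \<open>e\<close>. It drives the inductions over edge sets
  below.\<close>

lemma expect_insert:
  assumes "finite U" "e \<notin> U"
  shows "expect (insert e U) x f =
    x e * expect U x (\<lambda>w. f (w(e := True))) + (1 - x e) * expect U x (\<lambda>w. f (w(e := False)))"
proof -
  let ?g = "\<lambda>S. (\<Prod>e'\<in>insert e U. if e' \<in> S then x e' else 1 - x e') * f (\<lambda>e. e \<in> S)"
  have inj: "inj_on (insert e) (Pow U)"
    using assms(2) by (auto intro!: inj_onI)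
  have "expect (insert e U) x f = (\<Sum>S\<in>Pow U. ?g S) + (\<Sum>S\<in>insert e ` Pow U. ?g S)"
    unfolding expect_def Pow_insert using assms by (intro sum.union_disjoint) auto
  also have "(\<Sum>S\<in>insert e ` Pow U. ?g S) = (\<Sum>S\<in>Pow U. ?g (insert e S))"
    by (simp add: sum.reindex[OF inj])
  also have "\<dots> = x e * expect U x (\<lambda>w. f (w(e := True)))"
    unfolding expect_def sum_distrib_left
  proof (rule sum.cong)
    fix S assume "S \<in> Pow U"
    have "(\<Prod>e'\<in>U. if e' \<in> insert e S then x e' else 1 - x e') = (\<Prod>e'\<in>U. if e' \<in> S then x e' else 1 - x e')"
      using assms by (intro prod.cong) auto
    moreover have "(\<lambda>e'. e' \<in> insert e S) = (\<lambda>e. e \<in> S)(e := True)" by (auto simp: fun_eq_iff)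
    ultimately show "?g (insert e S) = x e * ((\<Prod>e'\<in>U. if e' \<in> S then x e' else 1 - x e')
        * f ((\<lambda>e. e \<in> S)(e := True)))"
      using assms by simp
  qed simp
  also have "(\<Sum>S\<in>Pow U. ?g S) = (1 - x e) * expect U x (\<lambda>w. f (w(e := False)))"
    unfolding expect_def sum_distrib_left
  proof (rule sum.cong)
    fix S assume S: "S \<in> Pow U"
    have "(\<lambda>e'. e' \<in> S) = (\<lambda>e. e \<in> S)(e := False)" using S assms by (auto simp: fun_eq_iff)
    moreover have "e \<notin> S" using S assms by auto
    ultimately show "?g S = (1 - x e) * ((\<Prod>e'\<in>U. if e' \<in> S then x e' else 1 - x e')
        * f ((\<lambda>e. e \<in> S)(e := False)))"
      using assms by simp
  qed simp
  finally show ?thesis by (simp only: add.commute)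
qed

lemma expect_cong_weight: "(\<And>e. e \<in> U \<Longrightarrow> x e = y e) \<Longrightarrow> expect U x f = expect U y f"
  unfolding expect_def by (intro sum.cong arg_cong2[where f = "(*)"] prod.cong) auto

lemma expect_remove:
  assumes "finite U" "e \<in> U"
  shows "expect U x f = x e * expect (U - {e}) x (\<lambda>w. f (w(e := True)))
    + (1 - x e) * expect (U - {e}) x (\<lambda>w. f (w(e := False)))"
proof -
  have "expect (insert e (U - {e})) x f = x e * expect (U - {e}) x (\<lambda>w. f (w(e := True)))
    + (1 - x e) * expect (U - {e}) x (\<lambda>w. f (w(e := False)))"
    by (rule expect_insert) (use assms in auto)
  thus ?thesis by (simp only: insert_Diff[OF assms(2)])
qed

lemma expect_const: "finite U \<Longrightarrow> expect U x (\<lambda>_. c) = c"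
  by (induction U rule: finite_induct) (simp_all add: expect_insert algebra_simps)

lemma expect_add: "expect U x (\<lambda>w. f w + g w) = expect U x f + expect U x g"
  by (simp add: expect_def algebra_simps sum.distrib)

lemma expect_diff: "expect U x (\<lambda>w. f w - g w) = expect U x f - expect U x g"
  by (simp add: expect_def algebra_simps sum_subtractf)

lemma expect_sum: "expect U x (\<lambda>w. \<Sum>i\<in>I. f i w) = (\<Sum>i\<in>I. expect U x (f i))"
  unfolding expect_def sum_distrib_left by (rule sum.swap)

lemma expect_mono:
  assumes "\<And>e. e \<in> U \<Longrightarrow> x e \<in> {0..1}" "\<And>w. f w \<le> g w"
  shows "expect U x f \<le> expect U x g"
  unfolding expect_def using assms
  by (intro sum_mono mult_left_mono prod_nonneg) auto

lemma expect_nonneg: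
  assumes "\<And>e. e \<in> U \<Longrightarrow> x e \<in> {0..1}" "\<And>w. 0 \<le> f w"
  shows "0 \<le> expect U x f"
  unfolding expect_def using assms
  by (intro sum_nonneg mult_nonneg_nonneg prod_nonneg) auto

text \<open>A coordinate that \<open>f\<close> ignores integrates out, because its two weights add
  up to 1.\<close>

lemma expect_restrict:
  assumes "finite U" "depends_on A f" "A \<subseteq> U"
  shows "expect U x f = expect A x f"
proof -
  have "finite (U - A)" using assms by auto
  hence "expect (A \<union> (U - A)) x f = expect A x f"
  proof (induction "U - A" arbitrary: U rule: finite_induct)
    case empty
    thus ?case by (simp add: Un_absorb2)
  next
    case (insert e F)
    have F: "F = U - insert e A" "finite F" "e \<notin> A" "F = (U - {e}) - A" using insert by auto
    have A: "finite (A \<union> (U - {e} - A)) \<or> infinite A" using F by auto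
    show ?case
    proof (cases "finite A")
      case True
      have eq: "A \<union> (U - A) = insert e (A \<union> ((U - {e}) - A))" using insert by auto
      have "expect (A \<union> (U - A)) x f = expect (A \<union> ((U - {e}) - A)) x f"
        unfolding eq using True F depends_on_upd_notin[OF assms(2) F(3)]
        by (subst expect_insert) (auto simp: algebra_simps)
      thus ?thesis using insert(3)[OF F(4)] by simp
    qed (use F assms in \<open>auto simp: expect_def\<close>)
  qed
  thus ?thesis using assms by (simp add: Un_absorb1)
qed

text \<open>Disjointness of \<open>A\<close> and \<open>B\<close> means that each new coordinate is
  invisible to at least one factor, and that factor pulls out of the conditioning.\<close>

lemma expect_indep:
  assumes "finite U" "depends_on A f" "depends_on B g" "A \<inter> B = {}"
  shows "expect U x (\<lambda>w. f w * g w) = expect U x f * expect U x g"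
  using assms
proof (induction U arbitrary: f g rule: finite_induct)
  case (insert e U)
  have IH: "expect U x (\<lambda>w. f (w(e := b)) * g (w(e := c))) =
    expect U x (\<lambda>w. f (w(e := b))) * expect U x (\<lambda>w. g (w(e := c)))" for b c
    using insert by (intro insert.IH depends_on_upd) auto
  consider "e \<notin> A" | "e \<notin> B" using insert by blast
  thus ?case
  proof cases
    case 1
    have "(\<lambda>w. f (w(e := b))) = f" for b
      by (rule ext) (rule depends_on_upd_notin[OF insert.prems(1) 1])
    with IH show ?thesis using insert.hyps by (simp add: expect_insert algebra_simps)
  next
    case 2
    have "(\<lambda>w. g (w(e := b))) = g" for b
      by (rule ext) (rule depends_on_upd_notin[OF insert.prems(2) 2])
    with IH show ?thesis using insert.hyps by (simp add: expect_insert algebra_simps)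
  qed
qed simp

lemma expect_coord: "finite U \<Longrightarrow> e \<in> U \<Longrightarrow> expect U x (\<lambda>w. of_bool (w e)) = x e"
  by (subst expect_remove) (auto simp: expect_const)

text \<open>Transports expectations into the tree, along the copy of the ray below a vertex and
  along shifts of subtrees. Outside \<open>A\<close> the map \<open>h\<close> may fold coordinates
  onto its image, so \<open>g\<close> may read only \<open>A\<close>.\<close>

lemma expect_reindex:
  assumes "inj_on h A" "depends_on A g"
  shows "expect (h ` A) x (\<lambda>w. g (w \<circ> h)) = expect A (x \<circ> h) g"
proof -
  have inj: "inj_on ((`) h) (Pow A)"
    using assms(1) by (simp add: inj_on_image_Pow)
  have "expect (h ` A) x (\<lambda>w. g (w \<circ> h)) = (\<Sum>S\<in>(`) h ` Pow A.
      (\<Prod>e\<in>h ` A. if e \<in> S then x e else 1 - x e) * g ((\<lambda>e. e \<in> S) \<circ> h))"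
    unfolding expect_def by (simp add: image_Pow_surj)
  also have "\<dots> = (\<Sum>S\<in>Pow A.
      (\<Prod>e\<in>h ` A. if e \<in> h ` S then x e else 1 - x e) * g ((\<lambda>e. e \<in> h ` S) \<circ> h))"
    by (simp add: sum.reindex[OF inj])
  also have "\<dots> = expect A (x \<circ> h) g"
    unfolding expect_def
  proof (rule sum.cong)
    fix S assume S: "S \<in> Pow A"
    have "(\<Prod>e\<in>h ` A. if e \<in> h ` S then x e else 1 - x e) =
      (\<Prod>e\<in>A. if e \<in> S then (x \<circ> h) e else 1 - (x \<circ> h) e)"
      using S by (subst prod.reindex[OF assms(1)])
        (auto intro!: prod.cong simp: inj_on_image_mem_iff[OF assms(1)])
    moreover have "g ((\<lambda>e. e \<in> h ` S) \<circ> h) = g (\<lambda>e. e \<in> S)"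
      using S by (intro depends_onD[OF assms(2)]) (simp add: inj_on_image_mem_iff[OF assms(1)])
    ultimately show "(\<Prod>e\<in>h ` A. if e \<in> h ` S then x e else 1 - x e) * g ((\<lambda>e. e \<in> h ` S) \<circ> h) =
      (\<Prod>e\<in>A. if e \<in> S then (x \<circ> h) e else 1 - (x \<circ> h) e) * g (\<lambda>e. e \<in> S)" by simp
  qed simp
  finally show ?thesis .
qed

section \<open>How expectations respond to a change of weights\<close>

text \<open>An expectation is affine in each single weight, and for an increasing event the slope is
  the probability that the edge is pivotal: Russo's formula for one edge, exact for finite
  increments.\<close>

lemma expect_weight_upd:
  assumes "finite U" "e \<in> U"
  shows "expect U (x(e := b)) f = expect U x f
    + (b - x e) * expect U x (\<lambda>w. f (w(e := True)) - f (w(e := False)))"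
proof -
  have [simp]: "expect (U - {e}) (x(e := b)) g = expect (U - {e}) x g" for g
    by (rule expect_cong_weight) auto
  show ?thesis
    using assms by (simp add: expect_remove[OF assms] expect_diff algebra_simps)
qed

lemma expect_mono_weight:
  assumes "finite U" "\<And>e. e \<in> U \<Longrightarrow> 0 \<le> x e" "\<And>e. e \<in> U \<Longrightarrow> x e \<le> y e" "\<And>e. e \<in> U \<Longrightarrow> y e \<le> 1"
    and "mono f"
  shows "expect U x f \<le> expect U y f"
  using assms
proof (induction U arbitrary: f rule: finite_induct)
  case (insert e U)
  have m: "mono (\<lambda>w. f (w(e := b)))" for b
    by (rule monoI, rule monoD[OF insert.prems(4)]) (simp add: le_fun_def)
  have IH: "expect U x (\<lambda>w. f (w(e := b))) \<le> expect U y (\<lambda>w. f (w(e := b)))" for b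
    using insert.prems by (intro insert.IH m) auto
  have yU: "e \<in> U \<Longrightarrow> y e \<in> {0..1}" for e
    using insert.prems by (auto intro: order_trans)
  have FT: "expect U y (\<lambda>w. f (w(e := False))) \<le> expect U y (\<lambda>w. f (w(e := True)))"
    by (rule expect_mono[OF yU], assumption, rule monoD[OF insert.prems(4)]) (simp add: le_fun_def)
  have "expect (insert e U) x f \<le> x e * expect U y (\<lambda>w. f (w(e := True)))
      + (1 - x e) * expect U y (\<lambda>w. f (w(e := False)))"
    unfolding expect_insert[OF insert.hyps]
    using insert.prems(1,2,3)[of e] IH by (intro add_mono mult_left_mono) auto
  also have "\<dots> = expect (insert e U) y f - (y e - x e) *
      (expect U y (\<lambda>w. f (w(e := True))) - expect U y (\<lambda>w. f (w(e := False))))"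
    unfolding expect_insert[OF insert.hyps] by (simp add: algebra_simps)
  also have "\<dots> \<le> expect (insert e U) y f"
    using FT insert.prems(2)[of e] by simp
  finally show ?case .
qed simp

text \<open>Let each open edge of \<open>A\<close> survive an extra coin of bias \<open>t\<close>:
  with probability \<open>t ^ card A\<close> all coins succeed and nothing is removed.\<close>

lemma expect_thinning:
  assumes "finite U" "\<And>e. e \<in> U \<Longrightarrow> x e \<in> {0..1}" "0 \<le> t" "t \<le> 1" "\<And>w. 0 \<le> f w"
    and "A \<subseteq> U"
  shows "t ^ card A * expect U x f \<le> expect U (\<lambda>e. if e \<in> A then t * x e else x e) f"
proof -
  have "finite A" using assms finite_subset by auto
  thus ?thesis using assms(6)
  proof (induction A rule: finite_induct)
    case (insert a A)
    let ?y = "\<lambda>e. if e \<in> A then t * x e else x e"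
    have a: "a \<in> U" using insert by auto
    have eq: "(\<lambda>e. if e \<in> insert a A then t * x e else x e) = ?y(a := t * x a)" by auto
    have y01: "?y e \<in> {0..1}" if "e \<in> U" for e
      using assms(2)[OF that] assms(3,4) by (auto intro: mult_le_one)
    have [simp]: "expect (U - {a}) (?y(a := t * x a)) g = expect (U - {a}) ?y g" for g
      by (rule expect_cong_weight) auto
    let ?T = "expect (U - {a}) ?y (\<lambda>w. f (w(a := True)))"
    let ?F = "expect (U - {a}) ?y (\<lambda>w. f (w(a := False)))"
    have F: "0 \<le> ?F" using y01 assms by (intro expect_nonneg) auto
    have "t * expect U ?y f = t * (x a * ?T + (1 - x a) * ?F)"
      using insert by (simp add: expect_remove[OF assms(1) a])
    also have "\<dots> \<le> t * x a * ?T + (1 - t * x a) * ?F"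
      using mult_right_mono[OF assms(4) F] by (simp add: algebra_simps)
    also have "\<dots> = expect U (?y(a := t * x a)) f"
      by (simp add: expect_remove[OF assms(1) a])
    finally have "t * expect U ?y f \<le> expect U (?y(a := t * x a)) f" .
    moreover have "t * (t ^ card A * expect U x f) \<le> t * expect U ?y f"
      using insert assms by (intro mult_left_mono) auto
    ultimately show ?case using insert unfolding eq by simp
  qed simp
qed

text \<open>Finite energy: with probability at least \<open>c ^ card L\<close>, independently of the
  other edges, the configuration already agrees with \<open>pat\<close> on \<open>L\<close>, and
  then overriding changes nothing.\<close>

lemma expect_override:
  assumes "finite U" "\<And>e. e \<in> U \<Longrightarrow> x e \<in> {0..1}" "L \<subseteq> U" "0 \<le> c" "\<And>w. 0 \<le> h w"
    and "\<And>e. e \<in> L \<Longrightarrow> c \<le> (if pat e then x e else 1 - x e)"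
  shows "c ^ card L * expect U x (\<lambda>w. h (\<lambda>e. if e \<in> L then pat e else w e)) \<le> expect U x h"
proof -
  have "finite L" using assms finite_subset by auto
  thus ?thesis using assms(3,6)
  proof (induction L rule: finite_induct)
    case (insert a L)
    have a: "a \<in> U" using insert by auto
    let ?h = "\<lambda>w. h (\<lambda>e. if e \<in> L then pat e else w e)"
    let ?E = "\<lambda>b. expect (U - {a}) x (\<lambda>w. ?h (w(a := b)))"
    have nn: "0 \<le> ?E b" for b using assms by (intro expect_nonneg) auto
    have eq: "(\<lambda>w. h (\<lambda>e. if e \<in> insert a L then pat e else w e)) = (\<lambda>w. ?h (w(a := pat a)))"
      using insert by (intro ext arg_cong[where f = h]) auto
    have "expect U x (\<lambda>w. ?h (w(a := pat a))) = ?E (pat a)"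
      by (simp add: expect_remove[OF assms(1) a] algebra_simps)
    hence "c * expect U x (\<lambda>w. ?h (w(a := pat a))) \<le> (if pat a then x a else 1 - x a) * ?E (pat a)"
      using insert.prems(2)[of a] nn[of "pat a"] by (simp only: mult_right_mono insertI1)
    also have "\<dots> \<le> x a * ?E True + (1 - x a) * ?E False"
      using nn[of True] nn[of False] assms(2)[OF a] by (cases "pat a") (simp_all only: if_True if_False, auto)
    also have "\<dots> = expect U x ?h" by (rule expect_remove[OF assms(1) a, symmetric])
    finally have "c * expect U x (\<lambda>w. ?h (w(a := pat a))) \<le> expect U x ?h" .
    hence "c ^ card L * (c * expect U x (\<lambda>w. ?h (w(a := pat a)))) \<le> c ^ card L * expect U x ?h"
      using assms(4) by (intro mult_left_mono) auto
    also have "\<dots> \<le> expect U x h" using insert by auto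
    finally show ?case using insert.hyps unfolding eq by (simp add: mult_ac)
  qed simp
qed

text \<open>Raising one weight by \<open>\<delta>\<close> adds \<open>\<delta>\<close> times the probability that the edge is pivotal.\<close>

lemma expect_raise:
  assumes "finite U" "M \<subseteq> U" "\<And>e. e \<in> M \<Longrightarrow> x e + \<delta> \<le> y e" "0 \<le> \<delta>" "0 \<le> c"
    and "\<And>w. 0 \<le> f w" "\<And>e. e \<in> U \<Longrightarrow> x e \<in> {0..1}"
    and pivotal: "\<And>N e. N \<subseteq> M \<Longrightarrow> e \<in> M \<Longrightarrow> c * expect U (\<lambda>e. if e \<in> N then y e else x e) f
      \<le> expect U (\<lambda>e. if e \<in> N then y e else x e) (\<lambda>w. f (w(e := True)) - f (w(e := False)))"
    and "\<And>e. e \<in> M \<Longrightarrow> y e \<le> 1"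
  shows "(1 + \<delta> * c) ^ card M * expect U x f \<le> expect U (\<lambda>e. if e \<in> M then y e else x e) f"
proof -
  have "finite M" using assms finite_subset by auto
  \<comment> \<open>Edges are switched from \<open>x\<close> to \<open>y\<close> one at a time; the
    pivotal bound is therefore needed at every mixed weight on the way, which is why it is assumed
    for all \<open>N\<close>.\<close>
  have "finite N \<Longrightarrow> N \<subseteq> M \<Longrightarrow>
    (1 + \<delta> * c) ^ card N * expect U x f \<le> expect U (\<lambda>e. if e \<in> N then y e else x e) f" for N
  proof (induction N rule: finite_induct)
    case (insert a N)
    let ?z = "\<lambda>e. if e \<in> N then y e else x e"
    let ?p = "\<lambda>w. f (w(a := True)) - f (w(a := False))"
    have a: "a \<in> U" "a \<in> M" using insert assms by auto
    have z01: "?z e \<in> {0..1}" if "e \<in> U" for e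
      using that insert.prems assms(3)[of e] assms(4) assms(7)[of e] assms(9)[of e] by auto
    have nn: "0 \<le> expect U ?z f" using z01 assms(6) by (rule expect_nonneg)
    have piv: "c * expect U ?z f \<le> expect U ?z ?p" using insert a by (intro pivotal) auto
    have eq: "(\<lambda>e. if e \<in> insert a N then y e else x e) = ?z(a := y a)" by auto
    have "(1 + \<delta> * c) * expect U ?z f = expect U ?z f + \<delta> * (c * expect U ?z f)"
      by (simp add: algebra_simps)
    also have "\<dots> \<le> expect U ?z f + (y a - ?z a) * expect U ?z ?p"
      using insert assms(3)[of a] a piv nn assms(4,5)
      by (intro add_left_mono mult_mono) auto
    also have "\<dots> = expect U (?z(a := y a)) f"
      by (rule expect_weight_upd[symmetric]) (use assms a in auto)
    finally have 1: "(1 + \<delta> * c) * expect U ?z f \<le> expect U (?z(a := y a)) f" .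
    have "(1 + \<delta> * c) * ((1 + \<delta> * c) ^ card N * expect U x f) \<le> (1 + \<delta> * c) * expect U ?z f"
      using insert assms(4,5) by (intro mult_left_mono) auto
    with 1 show ?case unfolding eq using insert by (simp add: mult_ac)
  qed auto
  thus ?thesis using \<open>finite M\<close> by auto
qed

subsection \<open>Percolation along a single ray\<close>

definition leap :: "nat \<Rightarrow> bool \<Rightarrow> nat" where
  "leap k l = (if l then k else 1)"

text \<open>An edge of the ray is coded by its starting point and a flag for a long jump, so the two
  parallel edges stay distinct when \<open>k = 1\<close>, as in the tree.\<close>

definition hop :: "nat \<Rightarrow> (nat \<times> bool \<Rightarrow> bool) \<Rightarrow> nat \<Rightarrow> nat \<Rightarrow> bool" where
  "hop k w i j \<longleftrightarrow> (\<exists>l. w (i, l) \<and> j = i + leap k l)"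

definition ray_edges :: "nat \<Rightarrow> nat \<Rightarrow> (nat \<times> bool) set" where
  "ray_edges k n = {(i, l). i + leap k l \<le> n}"

definition ray_weight :: "real \<Rightarrow> real \<Rightarrow> nat \<times> bool \<Rightarrow> real" where
  "ray_weight p q e = (if snd e then q else p)"

definition ray_event :: "nat \<Rightarrow> nat \<Rightarrow> (nat \<times> bool \<Rightarrow> bool) \<Rightarrow> real" where
  "ray_event k n w = of_bool ((hop k w)\<^sup>*\<^sup>* 0 n)"

text \<open>The \<pi>_n(p, q) of the overview. Paths only move forward, so edges ending beyond
  \<open>n\<close> cannot matter.\<close>

definition ray :: "nat \<Rightarrow> real \<Rightarrow> real \<Rightarrow> nat \<Rightarrow> real" where
  "ray k p q n = expect (ray_edges k n) (ray_weight p q) (ray_event k n)"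

lemma ray_weight_simps [simp]:
  "ray_weight p q (i, True) = q" "ray_weight p q (i, False) = p"
  by (simp_all add: ray_weight_def)

lemma hop_less: "hop k w i j \<Longrightarrow> 1 \<le> k \<Longrightarrow> i < j \<and> j \<le> i + k"
  by (auto simp: hop_def leap_def)

lemma reach_le: "(hop k w)\<^sup>*\<^sup>* i j \<Longrightarrow> 1 \<le> k \<Longrightarrow> i \<le> j"
  by (induction rule: rtranclp_induct) (auto dest: hop_less)

lemma finite_ray_edges: "1 \<le> k \<Longrightarrow> finite (ray_edges k n)"
  by (rule finite_subset[of _ "{..n} \<times> UNIV"]) (auto simp: ray_edges_def)

text \<open>Hops increase the position, so a path from \<open>a\<close> to \<open>c\<close> uses
  only edges contained in that interval.\<close>

lemma reach_transfer:
  assumes "(hop k w)\<^sup>*\<^sup>* a c" "1 \<le> k"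
    and "\<And>i l. a \<le> i \<Longrightarrow> i + leap k l \<le> c \<Longrightarrow> w (i, l) \<Longrightarrow> w' (i, l)"
  shows "(hop k w')\<^sup>*\<^sup>* a c"
  using assms(1,3)
proof (induction rule: converse_rtranclp_induct)
  case (step a b)
  from step(1) obtain l where l: "w (a, l)" "b = a + leap k l" by (auto simp: hop_def)
  have "b \<le> c" using reach_le[OF step(2) assms(2)] .
  hence "hop k w' a b" using l step.prems[of a l] by (auto simp: hop_def)
  moreover have "(hop k w')\<^sup>*\<^sup>* b c"
    using step.prems l by (intro step.IH) auto
  ultimately show ?case by simp
qed simp

lemma reach_last_before:
  assumes "(hop k w)\<^sup>*\<^sup>* a c" "1 \<le> k" "a \<le> m" "m \<le> c"
  shows "\<exists>i. (hop k w)\<^sup>*\<^sup>* a i \<and> i \<le> m \<and> m \<le> i + k"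
  using assms(1,3)
proof (induction rule: converse_rtranclp_induct)
  case base
  thus ?case using assms by (intro exI[of _ c]) auto
next
  case (step a b)
  show ?case
  proof (cases "b \<le> m")
    case True
    with step obtain i where "(hop k w)\<^sup>*\<^sup>* b i" "i \<le> m" "m \<le> i + k" by auto
    with step(1) show ?thesis by (meson converse_rtranclp_into_rtranclp)
  next
    case False
    with step hop_less[OF step(1) assms(2)] show ?thesis by (intro exI[of _ a]) auto
  qed
qed

lemma reach_first_after:
  assumes "(hop k w)\<^sup>*\<^sup>* a c" "1 \<le> k" "a \<le> m" "m \<le> c"
  shows "\<exists>j. (hop k w)\<^sup>*\<^sup>* j c \<and> m \<le> j \<and> j \<le> m + k"
  using assms(1,3)
proof (induction rule: converse_rtranclp_induct)
  case base
  thus ?case using assms by (intro exI[of _ c]) auto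
next
  case (step a b)
  show ?case
  proof (cases "b \<le> m")
    case True
    with step show ?thesis by auto
  next
    case False
    with step hop_less[OF step(1) assms(2)] show ?thesis by (intro exI[of _ b]) auto
  qed
qed

lemma reach_crosses:
  assumes "(hop k w)\<^sup>*\<^sup>* a c" "1 \<le> k" "a \<le> m" "m < c"
  shows "\<exists>i l. w (i, l) \<and> i \<le> m \<and> m < i + leap k l \<and> i + leap k l \<le> c"
  using assms(1,3)
proof (induction rule: converse_rtranclp_induct)
  case base
  thus ?case using assms by auto
next
  case (step a b)
  from step(1) obtain l where l: "w (a, l)" "b = a + leap k l" by (auto simp: hop_def)
  show ?case
  proof (cases "b \<le> m")
    case False
    with step l reach_le[OF step(2) assms(2)] show ?thesis by (intro exI[of _ a] exI[of _ l]) auto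
  qed (use step in auto)
qed

lemma reach_short:
  assumes "a \<le> b" "\<And>i. a \<le> i \<Longrightarrow> i < b \<Longrightarrow> w (i, False)"
  shows "(hop k w)\<^sup>*\<^sup>* a b"
  using assms
proof (induction b rule: dec_induct)
  case (step b)
  have "hop k w b (Suc b)" using step by (auto simp: hop_def leap_def intro: exI[of _ False])
  thus ?case using step by (auto intro: rtranclp.rtrancl_into_rtrancl)
qed simp

lemma reach_mono:
  assumes "w \<le> w'" "(hop k w)\<^sup>*\<^sup>* a c"
  shows "(hop k w')\<^sup>*\<^sup>* a c"
  using assms(2) by (rule rtranclp_mono[THEN predicate2D, rotated]) (use assms(1) in \<open>auto simp: hop_def le_fun_def\<close>)

lemma mono_ray_event: "mono (ray_event k n)"
  by (rule monoI) (auto simp: ray_event_def intro: reach_mono)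

lemma ray_event_nonneg: "0 \<le> ray_event k n w"
  by (simp add: ray_event_def)

lemma depends_on_ray_event: "1 \<le> k \<Longrightarrow> depends_on (ray_edges k n) (ray_event k n)"
  unfolding ray_event_def
  by (intro depends_onI arg_cong[where f = of_bool] iffI; erule reach_transfer)
    (auto simp: ray_edges_def)

text \<open>Modify a configuration connecting \<open>0\<close> to \<open>n\<close> near the edge \<open>(m, b)\<close>: close the other
  edges jumping over \<open>m\<close> and open the short edges around. Then \<open>(m, b)\<close> becomes pivotal.\<close>

definition over :: "nat \<Rightarrow> nat \<Rightarrow> nat \<times> bool \<Rightarrow> bool" where
  "over k m = (\<lambda>(i, l). i \<le> m \<and> m < i + leap k l)"

definition patch :: "nat \<Rightarrow> nat \<Rightarrow> nat \<Rightarrow> bool \<Rightarrow> (nat \<times> bool) set" where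
  "patch k n m b = {(i, l) \<in> ray_edges k n - {(m, b)}. over k m (i, l) \<or> \<not> l \<and> m \<le> i + k \<and> i < m + 2 * k}"

text \<open>The bound must not depend on \<open>m\<close> or \<open>n\<close>. Short edges are
  opened from \<open>k\<close> before \<open>m\<close>, where the old path was last seen, up to
  \<open>2 * k\<close> after it: one edge length plus an overshoot of at most \<open>k\<close>. This
  gives at most \<open>3 * k + 1\<close> starting points with two edges each.\<close>

lemma card_patch: 
  assumes "1 \<le> k"
  shows "card (patch k n m b) \<le> 6 * k + 2"
proof -
  have "patch k n m b \<subseteq> {m - k..m + 2 * k} \<times> UNIV"
    by (auto simp: patch_def over_def leap_def split: if_splits)
  hence "card (patch k n m b) \<le> card ({m - k..m + 2 * k} \<times> (UNIV :: bool set))"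
    by (intro card_mono) auto
  thus ?thesis by (simp add: card_cartesian_product)
qed

lemma patch_pivotal:
  fixes w :: "nat \<times> bool \<Rightarrow> bool"
  assumes "1 \<le> k" "(m, b) \<in> ray_edges k n" and reach: "(hop k w)\<^sup>*\<^sup>* 0 n"
  defines "w' \<equiv> \<lambda>e. if e \<in> patch k n m b then \<not> over k m e else w e"
  shows "(hop k (w'((m, b) := True)))\<^sup>*\<^sup>* 0 n" "\<not> (hop k (w'((m, b) := False)))\<^sup>*\<^sup>* 0 n"
proof -
  let ?e = "(m, b)" and ?v = "w'((m, b) := True)"
  have mn: "m + leap k b \<le> n" "m < m + leap k b" "leap k b \<le> k"
    using assms by (auto simp: ray_edges_def leap_def)
  \<comment> \<open>The new path follows the old one to its last vertex \<open>i\<close> at or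
    before \<open>m\<close>, takes short edges to \<open>m\<close>, then the edge itself, then short
    edges to the first old vertex \<open>j\<close> at or after its end, and rejoins the old path.
    The old pieces survive because none of their edges jumps over \<open>m\<close>.\<close>
  obtain i where i: "(hop k w)\<^sup>*\<^sup>* 0 i" "i \<le> m" "m \<le> i + k"
    using reach_last_before[OF reach assms(1), of m] mn by auto
  obtain j where j: "(hop k w)\<^sup>*\<^sup>* j n" "m + leap k b \<le> j" "j \<le> m + leap k b + k"
    using reach_first_after[OF reach assms(1), of "m + leap k b"] mn by auto
  have jn: "j \<le> n" using reach_le[OF j(1) assms(1)] .
  have "(hop k ?v)\<^sup>*\<^sup>* 0 i"
    using i(1) assms(1) by (rule reach_transfer) (use i(2) in \<open>auto simp: w'_def over_def\<close>)
  moreover have "(hop k ?v)\<^sup>*\<^sup>* i m"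
    using i mn by (intro reach_short) (auto simp: w'_def over_def patch_def ray_edges_def leap_def)
  moreover have "hop k ?v m (m + leap k b)" by (auto simp: hop_def)
  moreover have "(hop k ?v)\<^sup>*\<^sup>* (m + leap k b) j"
    using j mn jn by (intro reach_short) (auto simp: w'_def over_def patch_def ray_edges_def leap_def)
  moreover have "(hop k ?v)\<^sup>*\<^sup>* j n"
    using j(1) assms(1) by (rule reach_transfer) (use j mn in \<open>auto simp: w'_def over_def\<close>)
  ultimately show "(hop k ?v)\<^sup>*\<^sup>* 0 n"
    by (meson converse_rtranclp_into_rtranclp rtranclp_trans)
  show "\<not> (hop k (w'((m, b) := False)))\<^sup>*\<^sup>* 0 n"
  proof
    assume "(hop k (w'((m, b) := False)))\<^sup>*\<^sup>* 0 n"
    \<comment> \<open>Some edge has to carry the path from at most \<open>m\<close> to beyond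
      \<open>m\<close>, but all such edges other than \<open>(m, b)\<close> are closed by the
      patch.\<close>
    from reach_crosses[OF this assms(1), of m] mn obtain s l where
      sl: "(w'((m, b) := False)) (s, l)" "s \<le> m" "m < s + leap k l" "s + leap k l \<le> n" by auto
    show False
    proof (cases "(s, l) = (m, b)")
      case False
      hence "(s, l) \<in> patch k n m b" using sl by (auto simp: patch_def over_def ray_edges_def)
      with sl False show False by (simp add: w'_def over_def split: if_splits)
    qed (use sl in auto)
  qed
qed

section \<open>Exponential gain from raised weights and exponential cost of thinning\<close>

text \<open>Finite energy applied to the patch. The patch opens short edges only and merely closes
  long ones, so \<open>c\<close> bounds the short weights from below and all closing probabilities,
  while long weights may vanish.\<close>

lemma pivotal_probability:
  assumes "1 \<le> k" "(m, b) \<in> ray_edges k n" "0 \<le> c"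
    and x: "\<And>i l. 0 \<le> x (i, l)" "\<And>i l. x (i, l) \<le> 1 - c" "\<And>i. c \<le> x (i, False)"
  shows "c ^ (6 * k + 2) * expect (ray_edges k n) x (ray_event k n)
    \<le> expect (ray_edges k n) x
        (\<lambda>w. ray_event k n (w((m, b) := True)) - ray_event k n (w((m, b) := False)))"
proof -
  let ?U = "ray_edges k n" and ?L = "patch k n m b"
  let ?h = "\<lambda>w. ray_event k n (w((m, b) := True)) - ray_event k n (w((m, b) := False))"
  have x01: "x e \<in> {0..1}" for e
    using x(1)[of "fst e" "snd e"] x(2)[of "fst e" "snd e"] assms(3) by auto
  have c1: "c \<le> 1" using x(1)[of 0 False] x(2)[of 0 False] by simp
  have h0: "0 \<le> ?h w" for w
    using monoD[OF mono_ray_event[of k n], of "w((m, b) := False)" "w((m, b) := True)"]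
    by (simp add: le_fun_def)
  have "expect ?U x (ray_event k n)
      \<le> expect ?U x (\<lambda>w. ?h (\<lambda>e. if e \<in> ?L then \<not> over k m e else w e))"
  proof (rule expect_mono[OF x01])
    fix w show "ray_event k n w \<le> ?h (\<lambda>e. if e \<in> ?L then \<not> over k m e else w e)"
    proof (cases "(hop k w)\<^sup>*\<^sup>* 0 n")
      case True
      show ?thesis unfolding ray_event_def
        using patch_pivotal[OF assms(1,2) True] True by simp
    next
      case False
      thus ?thesis using h0 by (simp add: ray_event_def)
    qed
  qed
  moreover have "c ^ (6 * k + 2) \<le> c ^ card ?L"
    using card_patch[OF assms(1)] c1 assms(3) by (intro power_decreasing) auto
  moreover have "0 \<le> expect ?U x (ray_event k n)"
    using x01 by (intro expect_nonneg) (simp_all add: ray_event_def)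
  ultimately have "c ^ (6 * k + 2) * expect ?U x (ray_event k n)
    \<le> c ^ card ?L * expect ?U x (\<lambda>w. ?h (\<lambda>e. if e \<in> ?L then \<not> over k m e else w e))"
    using assms(3) by (intro mult_mono) auto
  also have "\<dots> \<le> expect ?U x ?h"
  proof (rule expect_override[OF _ x01 _ _ h0])
    fix e assume "e \<in> ?L"
    then obtain i l where e: "e = (i, l)" "over k m (i, l) \<or> \<not> l" by (auto simp: patch_def)
    show "c \<le> (if \<not> over k m e then x e else 1 - x e)"
      using x(2)[of i l] x(3)[of i] e by (cases l) (auto simp: algebra_simps)
  qed (use assms finite_ray_edges in \<open>auto simp: patch_def\<close>)
  finally show ?thesis .
qed

text \<open>\<open>M\<close> will be the set of all short or of all long edges. One constant
  \<open>c\<close> has to serve every intermediate weight: short weights never drop below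
  \<open>p\<close>, and closing probabilities never below \<open>1 - max p' q'\<close>.\<close>

lemma ray_raise:
  assumes "1 \<le> k" "0 < p" "p \<le> p'" "p' < 1" "0 \<le> q" "q \<le> q'" "q' < 1"
    and "M \<subseteq> ray_edges k n" "\<And>i l. (i, l) \<in> M \<Longrightarrow> \<delta> \<le> (if l then q' - q else p' - p)" "0 \<le> \<delta>"
    and "\<And>e. e \<in> ray_edges k n - M \<Longrightarrow> ray_weight p' q' e = ray_weight p q e"
    and c: "c = min p (1 - max p' q')"
  shows "(1 + \<delta> * c ^ (6 * k + 2)) ^ card M * ray k p q n \<le> ray k p' q' n"
proof -
  let ?x = "ray_weight p q" and ?y = "ray_weight p' q'" and ?U = "ray_edges k n"
  have c0: "0 \<le> c" using assms by auto
  have "(1 + \<delta> * c ^ (6 * k + 2)) ^ card M * expect ?U ?x (ray_event k n)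
      \<le> expect ?U (\<lambda>e. if e \<in> M then ?y e else ?x e) (ray_event k n)"
  proof (rule expect_raise)
    fix N e assume N: "N \<subseteq> M" "e \<in> M"
    obtain m b where e: "e = (m, b)" by (cases e)
    show "c ^ (6 * k + 2) * expect ?U (\<lambda>e. if e \<in> N then ?y e else ?x e) (ray_event k n)
      \<le> expect ?U (\<lambda>e. if e \<in> N then ?y e else ?x e)
          (\<lambda>w. ray_event k n (w(e := True)) - ray_event k n (w(e := False)))"
      unfolding e using assms(1-7) N assms(8) c0
      by (intro pivotal_probability) (auto simp: e c ray_weight_def)
  next
    fix e assume "e \<in> M"
    thus "?x e + \<delta> \<le> ?y e" using assms(9)[of "fst e" "snd e"] by (auto simp: ray_weight_def)
  qed (use assms c0 finite_ray_edges in \<open>auto simp: ray_weight_def ray_event_def\<close>)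
  also have "expect ?U (\<lambda>e. if e \<in> M then ?y e else ?x e) (ray_event k n) = ray k p' q' n"
    unfolding ray_def using assms(11) by (intro expect_cong_weight) auto
  finally show ?thesis by (simp add: ray_def)
qed

lemma ray_nonneg: "p \<in> {0..1} \<Longrightarrow> q \<in> {0..1} \<Longrightarrow> 0 \<le> ray k p q n"
  unfolding ray_def by (rule expect_nonneg) (auto simp: ray_weight_def ray_event_def)

lemma short_edges: "{(i, l) \<in> ray_edges k n. \<not> l} = (\<lambda>i. (i, False)) ` {..<n}"
  by (auto simp: ray_edges_def leap_def)

lemma card_short_edges: "card {(i, l) \<in> ray_edges k n. \<not> l} = n"
  unfolding short_edges by (simp add: card_image inj_on_def)

lemma long_edges: "{(i, l) \<in> ray_edges k n. l} = (\<lambda>i. (i, True)) ` {..<n + 1 - k}"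
  by (auto simp: ray_edges_def leap_def)

lemma card_long_edges: "card {(i, l) \<in> ray_edges k n. l} = n + 1 - k"
  unfolding long_edges by (simp add: card_image inj_on_def)

lemma ray_strict_short:
  assumes "1 \<le> k" "0 < p" "p < p'" "p' < 1" "0 \<le> q" "q < 1"
  obtains r where "0 < r" "r < 1" "\<And>n. ray k p q n \<le> r ^ n * ray k p' q n"
proof -
  define \<eta> where "\<eta> = (p' - p) * min p (1 - max p' q) ^ (6 * k + 2)"
  have \<eta>: "0 < \<eta>" unfolding \<eta>_def using assms by (intro mult_pos_pos zero_less_power) auto
  have "(1 + \<eta>) ^ n * ray k p q n \<le> ray k p' q n" for n
  proof -
    have "(1 + \<eta>) ^ card {(i, l) \<in> ray_edges k n. \<not> l} * ray k p q n \<le> ray k p' q n"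
      unfolding \<eta>_def by (rule ray_raise) (use assms in \<open>auto simp: ray_weight_def\<close>)
    thus ?thesis by (simp only: card_short_edges)
  qed
  hence "ray k p q n \<le> (1 / (1 + \<eta>)) ^ n * ray k p' q n" for n
    using \<eta> by (simp add: field_simps power_one_over)
  with \<eta> show ?thesis by (intro that[of "1 / (1 + \<eta>)"]) auto
qed

lemma ray_strict_long:
  assumes "1 \<le> k" "0 < p" "p < 1" "0 \<le> q" "q < q'" "q' < 1"
  obtains r C where "0 < r" "r < 1" "0 < C" "\<And>n. ray k p q n \<le> C * r ^ n * ray k p q' n"
proof -
  define \<eta> where "\<eta> = (q' - q) * min p (1 - max p q') ^ (6 * k + 2)"
  have \<eta>: "0 < \<eta>" unfolding \<eta>_def using assms by (intro mult_pos_pos zero_less_power) auto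
  have 1: "(1 + \<eta>) ^ (n + 1 - k) * ray k p q n \<le> ray k p q' n" for n
  proof -
    have "(1 + \<eta>) ^ card {(i, l) \<in> ray_edges k n. l} * ray k p q n \<le> ray k p q' n"
      unfolding \<eta>_def by (rule ray_raise) (use assms in \<open>auto simp: ray_weight_def\<close>)
    thus ?thesis by (simp only: card_long_edges)
  qed
  have "ray k p q n \<le> (1 + \<eta>) ^ k * (1 / (1 + \<eta>)) ^ n * ray k p q' n" for n
  proof -
    \<comment> \<open>Only \<open>n + 1 - k\<close> long edges fit below \<open>n\<close>; the
      missing factors go into the constant \<open>(1 + \<eta>) ^ k\<close>. The exponent comparison
      also covers \<open>n + 1 < k\<close>, where the subtraction truncates to 0.\<close>
    have "(1 + \<eta>) ^ n * ray k p q n \<le> (1 + \<eta>) ^ (k + (n + 1 - k)) * ray k p q n"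
      using assms \<eta> by (intro mult_right_mono power_increasing ray_nonneg) auto
    also have "\<dots> = (1 + \<eta>) ^ k * ((1 + \<eta>) ^ (n + 1 - k) * ray k p q n)"
      by (simp only: power_add mult.assoc)
    also have "\<dots> \<le> (1 + \<eta>) ^ k * ray k p q' n"
      using 1 \<eta> by (intro mult_left_mono) auto
    finally show ?thesis using \<eta> by (simp add: field_simps power_one_over)
  qed
  with \<eta> show ?thesis by (intro that[of "1 / (1 + \<eta>)" "(1 + \<eta>) ^ k"]) auto
qed

lemma ray_mono:
  assumes "1 \<le> k" "0 \<le> p" "p \<le> p'" "p' \<le> 1" "0 \<le> q" "q \<le> q'" "q' \<le> 1"
  shows "ray k p q n \<le> ray k p' q' n"
  unfolding ray_def using assms
  by (intro expect_mono_weight finite_ray_edges mono_ray_event) (auto simp: ray_weight_def)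

text \<open>A multiplicative change of a parameter costs at most an exponential factor, the same
  scale as the growth \<open>d ^ n\<close> and as the gain from raising weights, so the three can be
  balanced.\<close>

lemma ray_thin_short:
  assumes "1 \<le> k" "p \<in> {0..1}" "q \<in> {0..1}" "t \<in> {0..1}"
  shows "t ^ n * ray k p q n \<le> ray k (t * p) q n"
proof -
  let ?M = "{(i, l) \<in> ray_edges k n. \<not> l}"
  have "t ^ card ?M * ray k p q n
    \<le> expect (ray_edges k n) (\<lambda>e. if e \<in> ?M then t * ray_weight p q e else ray_weight p q e) (ray_event k n)"
    unfolding ray_def using assms
    by (intro expect_thinning finite_ray_edges ray_event_nonneg) (auto simp: ray_weight_def)
  also have "\<dots> = ray k (t * p) q n"
    unfolding ray_def by (intro expect_cong_weight) (auto simp: ray_weight_def)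
  finally show ?thesis by (simp only: card_short_edges)
qed

lemma ray_thin_long:
  assumes "1 \<le> k" "p \<in> {0..1}" "q \<in> {0..1}" "t \<in> {0..1}"
  shows "t ^ n * ray k p q n \<le> ray k p (t * q) n"
proof -
  let ?M = "{(i, l) \<in> ray_edges k n. l}"
  have "t ^ n * ray k p q n \<le> t ^ card ?M * ray k p q n"
    using assms by (intro mult_right_mono power_decreasing ray_nonneg) (auto simp: card_long_edges)
  also have "\<dots>
    \<le> expect (ray_edges k n) (\<lambda>e. if e \<in> ?M then t * ray_weight p q e else ray_weight p q e) (ray_event k n)"
    unfolding ray_def using assms
    by (intro expect_thinning finite_ray_edges ray_event_nonneg) (auto simp: ray_weight_def)
  also have "\<dots> = ray k p (t * q) n"
    unfolding ray_def by (intro expect_cong_weight) (auto simp: ray_weight_def)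
  finally show ?thesis .
qed

lemma ray_0 [simp]: "1 \<le> k \<Longrightarrow> ray k p q 0 = 1"
  by (simp add: ray_def ray_edges_def leap_def expect_const finite_ray_edges ray_event_def[abs_def])

lemma ray_leap_ge:
  assumes "1 \<le> k" "p \<in> {0..1}" "q \<in> {0..1}"
  shows "ray_weight p q (0, l) \<le> ray k p q (leap k l)"
proof -
  have "ray_weight p q (0, l) = expect (ray_edges k (leap k l)) (ray_weight p q) (\<lambda>w. of_bool (w (0, l)))"
    using assms by (intro expect_coord[symmetric] finite_ray_edges) (auto simp: ray_edges_def)
  also have "\<dots> \<le> ray k p q (leap k l)"
    unfolding ray_def
  proof (rule expect_mono)
    fix w :: "nat \<times> bool \<Rightarrow> bool"
    have "w (0, l) \<Longrightarrow> hop k w 0 (leap k l)" by (auto simp: hop_def)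
    thus "of_bool (w (0, l)) \<le> ray_event k (leap k l) w" by (auto simp: ray_event_def)
  qed (use assms in \<open>auto simp: ray_weight_def\<close>)
  finally show ?thesis .
qed

text \<open>Union bound over the last edge into \<open>n\<close>, which is independent of the edges
  lying before its starting point.\<close>

lemma ray_recursion:
  assumes "1 \<le> k" "p \<in> {0..1}" "q \<in> {0..1}" "1 \<le> n"
  shows "ray k p q n \<le> p * ray k p q (n - 1) + (if k \<le> n then q * ray k p q (n - k) else 0)"
proof -
  let ?U = "ray_edges k n" and ?x = "ray_weight p q"
  let ?g = "\<lambda>l w. ray_event k (n - leap k l) w * of_bool (w (n - leap k l, l))"
  have val: "expect ?U ?x (?g l) = ray k p q (n - leap k l) * ?x (n - leap k l, l)" if l: "leap k l \<le> n" for l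
  proof -
    have sub: "ray_edges k (n - leap k l) \<subseteq> ?U" by (auto simp: ray_edges_def)
    have "expect ?U ?x (?g l) = expect ?U ?x (ray_event k (n - leap k l)) *
      expect ?U ?x (\<lambda>w. of_bool (w (n - leap k l, l)))"
      using assms finite_ray_edges
      by (intro expect_indep[where A = "ray_edges k (n - leap k l)" and B = "{(n - leap k l, l)}"]
          depends_on_ray_event depends_onI) (auto simp: ray_edges_def leap_def)
    also have "expect ?U ?x (ray_event k (n - leap k l)) = ray k p q (n - leap k l)"
      unfolding ray_def using assms
      by (intro expect_restrict[OF _ depends_on_ray_event sub] finite_ray_edges) auto
    also have "expect ?U ?x (\<lambda>w. of_bool (w (n - leap k l, l))) = ?x (n - leap k l, l)"
      using assms l by (intro expect_coord finite_ray_edges) (auto simp: ray_edges_def)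
    finally show ?thesis .
  qed
  have ev: "ray_event k n w \<le> ?g False w + (if k \<le> n then ?g True w else 0)" for w
  proof (cases "(hop k w)\<^sup>*\<^sup>* 0 n")
    case True
    then obtain i where "(hop k w)\<^sup>*\<^sup>* 0 i" "hop k w i n"
      using assms(4) by (cases rule: rtranclp.cases) auto
    then obtain l where "(hop k w)\<^sup>*\<^sup>* 0 i" "w (i, l)" "n = i + leap k l" by (auto simp: hop_def)
    thus ?thesis by (cases l) (auto simp: ray_event_def leap_def)
  qed (auto simp: ray_event_def)
  have "ray k p q n \<le> expect ?U ?x (\<lambda>w. ?g False w + (if k \<le> n then ?g True w else 0))"
    unfolding ray_def by (rule expect_mono[OF _ ev]) (use assms in \<open>auto simp: ray_weight_def\<close>)
  also have "\<dots> = expect ?U ?x (?g False) + (if k \<le> n then expect ?U ?x (?g True) else 0)"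
    using assms by (simp add: expect_add expect_const finite_ray_edges)
  also have "\<dots> = p * ray k p q (n - 1) + (if k \<le> n then q * ray k p q (n - k) else 0)"
    using assms val[of False] val[of True] by (simp add: leap_def mult.commute)
  finally show ?thesis .
qed

subsection \<open>From the ray to the tree\<close>

definition tree_reach :: "nat \<Rightarrow> nat \<Rightarrow> (edge \<Rightarrow> bool) \<Rightarrow> nat list \<Rightarrow> nat list \<Rightarrow> bool" where
  "tree_reach d k w = (open_step d k w)\<^sup>*\<^sup>*"

definition level :: "nat \<Rightarrow> nat \<Rightarrow> nat list set" where
  "level d n = {v. word d v \<and> length v = n}"

fun source :: "edge \<Rightarrow> nat list" where
  "source (Short u a) = u"
| "source (Long u r) = u"

fun target :: "edge \<Rightarrow> nat list" where
  "target (Short u a) = u @ [a]"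
| "target (Long u r) = u @ r"

definition tree_edges :: "nat \<Rightarrow> nat \<Rightarrow> nat \<Rightarrow> edge set" where
  "tree_edges d k n = {e \<in> edges d k. length (target e) \<le> n}"

text \<open>The copy of the ray on the way from the root to \<open>v\<close>; it is meaningful only
  while \<open>i + leap k l \<le> length v\<close>. Its edge weights do not depend on
  \<open>v\<close>, so all vertices of a level are equally likely to be reached.\<close>

fun along :: "nat \<Rightarrow> nat list \<Rightarrow> nat \<times> bool \<Rightarrow> edge" where
  "along k v (i, l) = (if l then Long (take i v) (take k (drop i v)) else Short (take i v) (v ! i))"

fun translate :: "nat list \<Rightarrow> edge \<Rightarrow> edge" where
  "translate r (Short u a) = Short (r @ u) a"
| "translate r (Long u s) = Long (r @ u) s"

definition hits :: "nat \<Rightarrow> nat \<Rightarrow> nat \<Rightarrow> (edge \<Rightarrow> bool) \<Rightarrow> bool" where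
  "hits d k n w \<longleftrightarrow> (\<exists>v\<in>level d n. tree_reach d k w [] v)"

definition level_prob :: "nat \<Rightarrow> nat \<Rightarrow> real \<Rightarrow> real \<Rightarrow> nat \<Rightarrow> real" where
  "level_prob d k p q n = expect (tree_edges d k n) (edge_prob p q) (\<lambda>w. of_bool (hits d k n w))"

lemma finite_level: "finite (level d n)"
  unfolding level_def word_def using finite_lists_length_eq[of "{1..d}" n] by auto

lemma card_level: "card (level d n) = d ^ n"
  unfolding level_def word_def using card_lists_length_eq[of "{1..d}" n] by auto

lemma finite_tree_edges: "finite (tree_edges d k n)"
proof -
  let ?W = "{xs. set xs \<subseteq> {1..d} \<and> length xs \<le> n}"
  have "finite ?W" by (rule finite_lists_length_le) simp
  moreover have "tree_edges d k n \<subseteq> case_prod Short ` (?W \<times> {1..d}) \<union> case_prod Long ` (?W \<times> ?W)"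
    by (auto simp: tree_edges_def edges_def word_def image_iff)
  ultimately show ?thesis by (meson finite_SigmaI finite_UnI finite_atLeastAtMost finite_imageI finite_subset)
qed

lemma tree_edges_subset: "tree_edges d k n \<subseteq> edges d k"
  by (auto simp: tree_edges_def)

lemma tree_edges_mono: "m \<le> n \<Longrightarrow> tree_edges d k m \<subseteq> tree_edges d k n"
  by (auto simp: tree_edges_def)

lemma edge_prob_unit: "p \<in> {0..1} \<Longrightarrow> q \<in> {0..1} \<Longrightarrow> edge_prob p q e \<in> {0..1}"
  by (cases e) (auto simp: edge_prob_def)

lemma word_append [simp]: "word d (u @ v) \<longleftrightarrow> word d u \<and> word d v"
  by (auto simp: word_def)

lemma word_take: "word d v \<Longrightarrow> word d (take i v)"
  by (auto simp: word_def dest: in_set_takeD)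

lemma word_drop: "word d v \<Longrightarrow> word d (drop i v)"
  by (auto simp: word_def dest: in_set_dropD)

lemma word_nth: "word d v \<Longrightarrow> i < length v \<Longrightarrow> v ! i \<in> {1..d}"
  by (auto simp: word_def dest: nth_mem)

lemma inj_along:
  assumes "n \<le> length v" "1 \<le> k"
  shows "inj_on (along k v) (ray_edges k n)"
proof (rule inj_onI)
  fix e e' assume e: "e \<in> ray_edges k n" "e' \<in> ray_edges k n" "along k v e = along k v e'"
  obtain i l j m where ij: "e = (i, l)" "e' = (j, m)" by (metis surj_pair)
  have len: "length (take i v) = i" "length (take j v) = j"
    using e assms ij by (auto simp: ray_edges_def)
  have lm: "take i v = take j v" "l = m"
    using e(3) ij by (auto split: if_splits)
  have "i = j" using arg_cong[OF lm(1), of length] unfolding len .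
  thus "e = e'" using ij lm by simp
qed

lemma along_subset:
  assumes "v \<in> level d n" "1 \<le> k"
  shows "along k v ` ray_edges k n \<subseteq> tree_edges d k n"
proof -
  have "along k v (i, l) \<in> tree_edges d k n" if "i + leap k l \<le> n" for i l
    using that assms word_take[of d v i] word_take[OF word_drop, of d v k i] word_nth[of d v i]
    by (auto simp: tree_edges_def edges_def level_def leap_def split: if_splits)
  thus ?thesis by (auto simp: ray_edges_def simp del: along.simps)
qed

text \<open>Every step appends letters, so a path ending at \<open>v\<close> visits prefixes of
  \<open>v\<close> only and is determined by the lengths it visits.\<close>

lemma tree_reach_along:
  assumes v: "v \<in> level d n" and k: "1 \<le> k"
  shows "tree_reach d k w [] v \<longleftrightarrow> (hop k (w \<circ> along k v))\<^sup>*\<^sup>* 0 n"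
proof
  have vn: "word d v" "length v = n" using v by (auto simp: level_def)
  have "(\<exists>s. v = u @ s) \<and> (hop k (w \<circ> along k v))\<^sup>*\<^sup>* (length u) n" if "tree_reach d k w u v" for u
    using that unfolding tree_reach_def
  proof (induction rule: converse_rtranclp_induct)
    case base
    show ?case by (simp add: vn)
  next
    case (step u u')
    then obtain s where s: "v = u' @ s" by blast
    from step(1) consider a where "u' = u @ [a]" "w (Short u a)"
      | r where "length r = k" "u' = u @ r" "w (Long u r)"
      by (auto simp: open_step_def)
    hence "(\<exists>t. u' = u @ t) \<and> hop k (w \<circ> along k v) (length u) (length u')"
    proof cases
      case 1
      thus ?thesis unfolding hop_def s by (intro conjI exI[of _ False]) (auto simp: leap_def)
    next
      case 2
      thus ?thesis unfolding hop_def s by (intro conjI exI[of _ True]) (auto simp: leap_def)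
    qed
    with step.IH s show ?case by (metis append.assoc converse_rtranclp_into_rtranclp)
  qed
  from this[of "[]"] show "tree_reach d k w [] v \<Longrightarrow> (hop k (w \<circ> along k v))\<^sup>*\<^sup>* 0 n" by simp
  have "j \<le> n \<Longrightarrow> tree_reach d k w [] (take j v)" if "(hop k (w \<circ> along k v))\<^sup>*\<^sup>* 0 j" for j
    using that
  proof (induction rule: rtranclp_induct)
    case (step i j)
    have ij: "i < j" using hop_less[OF step(2) k] by simp
    obtain l where l: "w (along k v (i, l))" "j = i + leap k l"
      using step(2) by (auto simp: hop_def simp del: along.simps)
    have "open_step d k w (take i v) (take j v)"
    proof (cases l)
      case True
      thus ?thesis using l step.prems vn unfolding open_step_def
        by (intro conjI disjI2 exI[of _ "take k (drop i v)"])
          (simp_all add: leap_def take_add word_take word_drop)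
    next
      case False
      thus ?thesis using l step.prems vn word_nth[of d v i] unfolding open_step_def
        by (intro conjI disjI1 bexI[of _ "v ! i"])
          (simp_all add: leap_def take_Suc_conv_app_nth word_take)
    qed
    moreover have "tree_reach d k w [] (take i v)" using step.IH step.prems ij by simp
    ultimately show ?case unfolding tree_reach_def by (rule rtranclp.rtrancl_into_rtrancl[rotated])
  qed (simp add: tree_reach_def)
  from this[of n] show "(hop k (w \<circ> along k v))\<^sup>*\<^sup>* 0 n \<Longrightarrow> tree_reach d k w [] v"
    using vn by simp
qed

lemma depends_on_reindex:
  assumes "depends_on A f"
  shows "depends_on (h ` A) (\<lambda>w. f (w \<circ> h))"
  by (rule depends_onI, rule depends_onD[OF assms]) auto

lemma of_bool_tree_reach:
  assumes "v \<in> level d n" "1 \<le> k"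
  shows "of_bool (tree_reach d k w [] v) = ray_event k n (w \<circ> along k v)"
  by (simp add: ray_event_def tree_reach_along[OF assms])

lemma depends_on_tree_reach:
  assumes "v \<in> level d n" "1 \<le> k"
  shows "depends_on (tree_edges d k n) (\<lambda>w. of_bool (tree_reach d k w [] v) :: real)"
  unfolding of_bool_tree_reach[OF assms]
  using depends_on_reindex[OF depends_on_ray_event[OF assms(2)]] along_subset[OF assms]
  by (rule depends_on_mono)

text \<open>The larger level \<open>m\<close> allows events at different depths to be compared over
  one common edge set.\<close>

lemma expect_tree_reach:
  assumes "v \<in> level d n" "1 \<le> k" "n \<le> m"
  shows "expect (tree_edges d k m) (edge_prob p q) (\<lambda>w. of_bool (tree_reach d k w [] v)) = ray k p q n"
proof -
  have "expect (tree_edges d k m) (edge_prob p q) (\<lambda>w. of_bool (tree_reach d k w [] v))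
    = expect (along k v ` ray_edges k n) (edge_prob p q) (\<lambda>w. ray_event k n (w \<circ> along k v))"
    unfolding of_bool_tree_reach[OF assms(1,2)]
    by (intro expect_restrict finite_tree_edges depends_on_reindex depends_on_ray_event assms
        order_trans[OF along_subset[OF assms(1,2)] tree_edges_mono[OF assms(3)]])
  also have "\<dots> = expect (ray_edges k n) (edge_prob p q \<circ> along k v) (ray_event k n)"
    using assms by (intro expect_reindex inj_along depends_on_ray_event) (auto simp: level_def)
  also have "edge_prob p q \<circ> along k v = ray_weight p q"
    by (auto simp: fun_eq_iff edge_prob_def ray_weight_def)
  finally show ?thesis by (simp add: ray_def)
qed

lemma depends_on_hits:
  assumes "1 \<le> k"
  shows "depends_on (tree_edges d k n) (hits d k n)"
proof (rule depends_onI)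
  fix w w' :: "edge \<Rightarrow> bool"
  assume "\<And>e. e \<in> tree_edges d k n \<Longrightarrow> w e = w' e"
  hence "tree_reach d k w [] v = tree_reach d k w' [] v" if "v \<in> level d n" for v
    using depends_onD[OF depends_on_tree_reach[OF that assms], of w w', unfolded of_bool_eq_iff] by blast
  thus "hits d k n w = hits d k n w'" by (auto simp: hits_def)
qed

text \<open>First moment bound over the \<open>d ^ n\<close> vertices of the level.\<close>

lemma level_prob_le:
  assumes "1 \<le> k" "p \<in> {0..1}" "q \<in> {0..1}"
  shows "level_prob d k p q n \<le> real d ^ n * ray k p q n"
proof -
  have "level_prob d k p q n \<le> expect (tree_edges d k n) (edge_prob p q)
      (\<lambda>w. \<Sum>v\<in>level d n. of_bool (tree_reach d k w [] v))"
    unfolding level_prob_def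
  proof (rule expect_mono[OF edge_prob_unit[OF assms(2,3)]])
    fix w
    show "of_bool (hits d k n w) \<le> (\<Sum>v\<in>level d n. of_bool (tree_reach d k w [] v) :: real)"
    proof (cases "hits d k n w")
      case True
      then obtain v where "v \<in> level d n" "tree_reach d k w [] v" by (auto simp: hits_def)
      thus ?thesis
        using member_le_sum[of v "level d n" "\<lambda>v. of_bool (tree_reach d k w [] v) :: real"] finite_level True
        by simp
    qed (simp add: sum_nonneg)
  qed
  also have "\<dots> = (\<Sum>v\<in>level d n. ray k p q n)"
    unfolding expect_sum by (intro sum.cong expect_tree_reach refl assms order_refl)
  finally show ?thesis by (simp add: card_level)
qed

section \<open>Self-similarity: subtrees as shifted copies of the tree\<close>

lemma inj_translate: "inj (translate r)"
proof (rule injI)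
  fix e e' show "translate r e = translate r e' \<Longrightarrow> e = e'" by (cases e; cases e') auto
qed

lemma edge_prob_translate [simp]: "edge_prob p q (translate r e) = edge_prob p q e"
  by (cases e) (auto simp: edge_prob_def)

lemma source_translate [simp]: "source (translate r e) = r @ source e"
  by (cases e) auto

lemma target_translate [simp]: "target (translate r e) = r @ target e"
  by (cases e) auto

lemma translate_subset:
  assumes "r \<in> level d n"
  shows "translate r ` tree_edges d k m \<subseteq> tree_edges d k (n + m)"
  using assms by (auto simp: tree_edges_def edges_def level_def)

lemma length_source_less: "e \<in> edges d k \<Longrightarrow> 1 \<le> k \<Longrightarrow> length (source e) < length (target e)"
  by (auto simp: edges_def)

text \<open>The level of the target separates the two families. Long edges jumping across level
  \<open>n\<close> lie in neither, so paths that skip this level are lost and the branching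
  estimates are only lower bounds.\<close>

lemma translate_disjoint_base:
  assumes "r \<in> level d n" "1 \<le> k"
  shows "tree_edges d k n \<inter> translate r ` tree_edges d k m = {}"
proof -
  have "length (target (translate r e)) > n" if "e \<in> tree_edges d k m" for e
    using length_source_less[of e d k] that assms by (auto simp: tree_edges_def level_def)
  thus ?thesis by (fastforce simp: tree_edges_def)
qed

lemma translate_disjoint:
  assumes "r \<in> level d n" "r' \<in> level d n" "r \<noteq> r'"
  shows "translate r ` A \<inter> translate r' ` B = {}"
proof -
  have "translate r e \<noteq> translate r' e'" for e e'
  proof
    assume "translate r e = translate r' e'"
    hence "take n (source (translate r e)) = take n (source (translate r' e'))" by simp
    thus False using assms by (simp add: level_def)
  qed
  thus ?thesis by auto
qed

lemma tree_reach_translate: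
  assumes "word d r" "tree_reach d k (w \<circ> translate r) u v"
  shows "tree_reach d k w (r @ u) (r @ v)"
  using assms(2) unfolding tree_reach_def
proof (induction rule: rtranclp_induct)
  case (step v v')
  have "open_step d k w (r @ v) (r @ v')"
    using step(2) assms(1) unfolding open_step_def by auto
  with step show ?case by auto
qed simp

lemma hits_append:
  assumes "r \<in> level d n" "tree_reach d k w [] r" "hits d k m (w \<circ> translate r)"
  shows "hits d k (n + m) w"
proof -
  obtain v where v: "v \<in> level d m" "tree_reach d k (w \<circ> translate r) [] v"
    using assms(3) by (auto simp: hits_def)
  have "tree_reach d k w r (r @ v)"
    using tree_reach_translate[OF _ v(2)] assms(1) by (simp add: level_def)
  with assms(2) have "tree_reach d k w [] (r @ v)" by (auto simp: tree_reach_def)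
  moreover have "r @ v \<in> level d (n + m)" using v(1) assms(1) by (simp add: level_def)
  ultimately show ?thesis unfolding hits_def by blast
qed

lemma depends_on_hits_translate:
  assumes "1 \<le> k"
  shows "depends_on (translate r ` tree_edges d k m) (\<lambda>w. of_bool (hits d k m (w \<circ> translate r)) :: real)"
  by (rule depends_on_reindex[where f = "\<lambda>w. of_bool (hits d k m w)"])
    (rule depends_on_compose[OF depends_on_hits[OF assms]])

lemma expect_hits_translate:
  assumes "r \<in> level d n" "1 \<le> k"
  shows "expect (tree_edges d k (n + m)) (edge_prob p q) (\<lambda>w. of_bool (hits d k m (w \<circ> translate r)))
    = level_prob d k p q m"
proof -
  have "expect (tree_edges d k (n + m)) (edge_prob p q) (\<lambda>w. of_bool (hits d k m (w \<circ> translate r)))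
    = expect (translate r ` tree_edges d k m) (edge_prob p q) (\<lambda>w. of_bool (hits d k m (w \<circ> translate r)))"
    by (rule expect_restrict[OF finite_tree_edges depends_on_hits_translate[OF assms(2)] translate_subset[OF assms(1)]])
  also have "\<dots> = expect (tree_edges d k m) (edge_prob p q \<circ> translate r) (\<lambda>w. of_bool (hits d k m w))"
    by (rule expect_reindex[where g = "\<lambda>w. of_bool (hits d k m w)"])
      (rule inj_on_subset[OF inj_translate subset_UNIV] depends_on_compose[OF depends_on_hits[OF assms(2)]])+
  also have "edge_prob p q \<circ> translate r = edge_prob p q" by (auto simp: fun_eq_iff)
  finally show ?thesis unfolding level_prob_def .
qed

lemma expect_branch:
  assumes "r \<in> level d n" "1 \<le> k"
  shows "expect (tree_edges d k (n + m)) (edge_prob p q)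
      (\<lambda>w. of_bool (tree_reach d k w [] r) * of_bool (hits d k m (w \<circ> translate r)))
    = ray k p q n * level_prob d k p q m"
proof -
  have "expect (tree_edges d k (n + m)) (edge_prob p q)
      (\<lambda>w. of_bool (tree_reach d k w [] r) * of_bool (hits d k m (w \<circ> translate r)))
    = expect (tree_edges d k (n + m)) (edge_prob p q) (\<lambda>w. of_bool (tree_reach d k w [] r))
      * expect (tree_edges d k (n + m)) (edge_prob p q) (\<lambda>w. of_bool (hits d k m (w \<circ> translate r)))"
    by (rule expect_indep[OF finite_tree_edges depends_on_tree_reach[OF assms]
          depends_on_hits_translate[OF assms(2)] translate_disjoint_base[OF assms]])
  thus ?thesis unfolding expect_tree_reach[OF assms le_add1] expect_hits_translate[OF assms] .
qed

lemma level_prob_nonneg: "p \<in> {0..1} \<Longrightarrow> q \<in> {0..1} \<Longrightarrow> 0 \<le> level_prob d k p q n"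
  unfolding level_prob_def by (rule expect_nonneg[OF edge_prob_unit]) auto

lemma level_prob_0: "level_prob d k p q 0 = 1"
proof -
  have "hits d k 0 w" for w
    unfolding hits_def by (rule bexI[of _ "[]"]) (simp_all add: level_def word_def tree_reach_def)
  thus ?thesis by (simp add: level_prob_def expect_const finite_tree_edges)
qed

section \<open>Branching lower bounds for level probabilities\<close>

lemma level_prob_single_branch:
  assumes "1 \<le> d" "1 \<le> k" "p \<in> {0..1}" "q \<in> {0..1}"
  shows "ray k p q n * level_prob d k p q m \<le> level_prob d k p q (n + m)"
proof -
  \<comment> \<open>Any fixed word of length \<open>n\<close> would serve as the single
    branch.\<close>
  have r: "replicate n 1 \<in> level d n" using assms(1) by (auto simp: level_def word_def)
  have "ray k p q n * level_prob d k p q m = expect (tree_edges d k (n + m)) (edge_prob p q)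
      (\<lambda>w. of_bool (tree_reach d k w [] (replicate n 1)) * of_bool (hits d k m (w \<circ> translate (replicate n 1))))"
    by (rule expect_branch[OF r assms(2), symmetric])
  also have "\<dots> \<le> level_prob d k p q (n + m)"
    unfolding level_prob_def
  proof (rule expect_mono[OF edge_prob_unit[OF assms(3,4)]])
    fix w
    show "of_bool (tree_reach d k w [] (replicate n 1)) * of_bool (hits d k m (w \<circ> translate (replicate n 1)))
      \<le> (of_bool (hits d k (n + m) w) :: real)"
      using hits_append[OF r, of k w m] by (auto simp del: One_nat_def)
  qed
  finally show ?thesis .
qed

text \<open>With X the number of \<open>r\<close> satisfying both conditions, X - X (X - 1) \<le> 1
  if X > 0. Pairs are ordered, hence counted twice, and dropping \<open>B\<close> from them only
  enlarges the subtracted sum.\<close>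

lemma bonferroni:
  fixes B G :: "'a \<Rightarrow> bool"
  assumes "finite R"
  shows "(\<Sum>r\<in>R. of_bool (B r) * of_bool (G r))
      - (\<Sum>(r, r')\<in>{(r, r'). r \<in> R \<and> r' \<in> R \<and> r \<noteq> r'}. of_bool (G r) * of_bool (G r'))
    \<le> (of_bool (\<exists>r\<in>R. B r \<and> G r) :: real)"
proof -
  let ?X = "{r \<in> R. B r \<and> G r}" and ?P = "{(r, r'). r \<in> R \<and> r' \<in> R \<and> r \<noteq> r'}"
  let ?D = "(\<lambda>r. (r, r)) ` ?X"
  let ?g = "\<lambda>(r, r'). of_bool (G r) * of_bool (G r') :: real"
  have fin: "finite ?X" using assms by simp
  have finP: "finite ?P" by (rule finite_subset[of _ "R \<times> R"]) (use assms in auto)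
  have 1: "(\<Sum>r\<in>R. of_bool (B r) * of_bool (G r)) = real (card ?X)"
    using assms by (simp add: of_bool_conj[symmetric] sum_of_bool_eq Int_def)
  have sq: "card (?X \<times> ?X - ?D) = card ?X * card ?X - card ?X"
    using fin by (subst card_Diff_subset) (auto simp: card_image inj_on_def card_cartesian_product)
  have "real (card ?X * card ?X - card ?X) = (\<Sum>x\<in>?X \<times> ?X - ?D. 1)" by (simp add: sq)
  also have "\<dots> \<le> (\<Sum>x\<in>?X \<times> ?X - ?D. ?g x)" by (intro sum_mono) auto
  also have "\<dots> \<le> (\<Sum>x\<in>?P. ?g x)" by (intro sum_mono2 finP) auto
  finally have 2: "real (card ?X * card ?X - card ?X) \<le> (\<Sum>x\<in>?P. ?g x)" .
  show ?thesis
  proof (cases "card ?X")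
    case 0
    have "0 \<le> (\<Sum>x\<in>?P. ?g x)" by (intro sum_nonneg) auto
    moreover have "(0 :: real) \<le> of_bool (\<exists>r\<in>R. B r \<and> G r)" by simp
    ultimately show ?thesis unfolding 1 0 by linarith
  next
    case (Suc s)
    hence "?X \<noteq> {}" by force
    hence ex: "\<exists>r\<in>R. B r \<and> G r" by auto
    have "real s \<le> real (card ?X * card ?X - card ?X)"
      unfolding Suc by (auto simp: algebra_simps)
    from order_trans[OF this 2] ex show ?thesis unfolding 1 Suc by simp
  qed
qed

text \<open>Reaching level \<open>n + m\<close> through level \<open>n\<close>, bounded below by inclusion-exclusion; in the
  second-order term the connections to level \<open>n\<close> are dropped.\<close>

lemma level_prob_branching:
  assumes "1 \<le> k" "p \<in> {0..1}" "q \<in> {0..1}"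
  shows "real d ^ n * ray k p q n * level_prob d k p q m - (real d ^ n * level_prob d k p q m)\<^sup>2
    \<le> level_prob d k p q (n + m)"
proof -
  let ?E = "expect (tree_edges d k (n + m)) (edge_prob p q)"
  let ?R = "level d n"
  let ?P = "{(r, r'). r \<in> ?R \<and> r' \<in> ?R \<and> r \<noteq> r'}"
  let ?B = "\<lambda>w r. tree_reach d k w [] r" and ?G = "\<lambda>w r. hits d k m (w \<circ> translate r)"
  let ?L = "level_prob d k p q m"
  have finP: "finite ?P" by (rule finite_subset[of _ "?R \<times> ?R"]) (auto simp: finite_level)
  have "card ?P \<le> card (?R \<times> ?R)" by (rule card_mono) (auto simp: finite_level)
  hence cardP: "real (card ?P) \<le> (real d ^ n)\<^sup>2"
    by (simp add: card_cartesian_product card_level power2_eq_square flip: of_nat_power of_nat_mult)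
  have 1: "?E (\<lambda>w. \<Sum>r\<in>?R. of_bool (?B w r) * of_bool (?G w r)) = real d ^ n * (ray k p q n * ?L)"
    unfolding expect_sum using assms(1) by (simp add: expect_branch card_level)
  have pair: "?E (\<lambda>w. of_bool (?G w r) * of_bool (?G w r')) = ?L * ?L"
    if "r \<in> ?R" "r' \<in> ?R" "r \<noteq> r'" for r r'
    using expect_indep[OF finite_tree_edges depends_on_hits_translate[OF assms(1)]
        depends_on_hits_translate[OF assms(1)] translate_disjoint[OF that], of d k "n + m" "edge_prob p q" d m d m]
      expect_hits_translate[OF that(1) assms(1)] expect_hits_translate[OF that(2) assms(1)] by simp
  have "?E (\<lambda>w. \<Sum>(r, r')\<in>?P. of_bool (?G w r) * of_bool (?G w r')) = (\<Sum>(r, r')\<in>?P. ?L * ?L)"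
    unfolding case_prod_beta expect_sum by (intro sum.cong refl pair) auto
  also have "\<dots> = real (card ?P) * ?L\<^sup>2" by (simp add: power2_eq_square)
  also have "\<dots> \<le> (real d ^ n)\<^sup>2 * ?L\<^sup>2" using cardP by (intro mult_right_mono) auto
  finally have 2: "?E (\<lambda>w. \<Sum>(r, r')\<in>?P. of_bool (?G w r) * of_bool (?G w r')) \<le> (real d ^ n * ?L)\<^sup>2"
    by (simp add: power_mult_distrib)
  have "?E (\<lambda>w. \<Sum>r\<in>?R. of_bool (?B w r) * of_bool (?G w r))
      - ?E (\<lambda>w. \<Sum>(r, r')\<in>?P. of_bool (?G w r) * of_bool (?G w r')) \<le> level_prob d k p q (n + m)"
    unfolding expect_diff[symmetric] level_prob_def
  proof (rule expect_mono[OF edge_prob_unit[OF assms(2,3)]])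
    fix w
    have "(of_bool (\<exists>r\<in>?R. ?B w r \<and> ?G w r) :: real) \<le> of_bool (hits d k (n + m) w)"
      using hits_append[of _ d n k w m] by auto
    with bonferroni[OF finite_level, of "?B w" "?G w" d n]
    show "(\<Sum>r\<in>?R. of_bool (?B w r) * of_bool (?G w r)) - (\<Sum>(r, r')\<in>?P. of_bool (?G w r) * of_bool (?G w r'))
      \<le> (of_bool (hits d k (n + m) w) :: real)" by linarith
  qed
  with 1 2 show ?thesis by (simp add: mult.assoc)
qed

text \<open>With \<open>M = d^n\<close> and \<open>\<mu> = d^n \<pi>_n > 1\<close>, the level probability \<open>\<theta>\<close> grows
  (\<open>\<mu> \<theta> - (M \<theta>)^2 \<ge> \<theta>\<close>) as long as \<open>\<theta> \<le> (\<mu> - 1) / M^2\<close>, and otherwise loses at most a factor \<open>\<pi>_n\<close>.\<close>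

lemma level_prob_bounded_below:
  assumes "1 \<le> d" "1 \<le> k" "p \<in> {0..1}" "q \<in> {0..1}" "1 < real d ^ n * ray k p q n"
  obtains c where "0 < c" "\<And>j. c \<le> level_prob d k p q (n * j)"
proof -
  define M where "M = real d ^ n"
  \<comment> \<open>The second entry is the threshold below which the quadratic loss does not
    outweigh the linear gain; the cap 1 serves the start of the induction, where the level
    probability is 1.\<close>
  define b where "b = min 1 ((M * ray k p q n - 1) / M\<^sup>2)"
  have M: "1 \<le> M" using assms(1) by (simp add: M_def)
  have ray: "0 < ray k p q n"
    using assms(5) ray_nonneg[OF assms(3,4), of k n] by (cases "ray k p q n = 0") auto
  have ray1: "ray k p q n \<le> 1"
  proof -
    have "ray k p q n \<le> expect (ray_edges k n) (ray_weight p q) (\<lambda>_. 1)"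
      unfolding ray_def by (rule expect_mono) (use assms in \<open>auto simp: ray_weight_def ray_event_def\<close>)
    thus ?thesis using assms by (simp add: expect_const finite_ray_edges)
  qed
  have b: "0 < b" "b \<le> 1" "M\<^sup>2 * b \<le> M * ray k p q n - 1"
  proof -
    have M2: "0 < M\<^sup>2" using M by simp
    show "0 < b" "b \<le> 1" using M2 assms(5) by (auto simp: b_def M_def)
    have "M\<^sup>2 * b \<le> M\<^sup>2 * ((M * ray k p q n - 1) / M\<^sup>2)"
      using M2 by (intro mult_left_mono) (auto simp: b_def)
    thus "M\<^sup>2 * b \<le> M * ray k p q n - 1" using M2 by simp
  qed
  \<comment> \<open>The invariant is weaker than \<open>b\<close> itself: from a value above
    \<open>b\<close> one step may lose the factor \<open>ray k p q n\<close>, after which the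
    quantity cannot decrease until it exceeds \<open>b\<close> again.\<close>
  have "ray k p q n * b \<le> level_prob d k p q (n * j)" for j
  proof (induction j)
    case 0
    show ?case using ray1 b ray by (auto simp: level_prob_0 intro: mult_le_one)
  next
    case (Suc j)
    let ?L = "level_prob d k p q (n * j)"
    have L0: "0 \<le> ?L" using assms by (intro level_prob_nonneg) auto
    show ?case
    proof (cases "?L \<le> b")
      case True
      have "M\<^sup>2 * ?L * ?L \<le> M\<^sup>2 * b * ?L" using True L0 by (intro mult_right_mono mult_left_mono) auto
      also have "\<dots> \<le> (M * ray k p q n - 1) * ?L" using b L0 by (intro mult_right_mono) auto
      finally have "?L \<le> M * ray k p q n * ?L - (M * ?L)\<^sup>2"
        by (simp add: algebra_simps power2_eq_square)
      also have "\<dots> \<le> level_prob d k p q (n + n * j)"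
        using level_prob_branching[of k p q d n "n * j"] assms by (simp add: M_def)
      finally show ?thesis using Suc by simp
    next
      case False
      hence "ray k p q n * b \<le> ray k p q n * ?L" using ray by simp
      also have "\<dots> \<le> level_prob d k p q (n + n * j)"
        using assms by (intro level_prob_single_branch) auto
      finally show ?thesis by simp
    qed
  qed
  thus ?thesis using that[of "ray k p q n * b"] ray b by auto
qed

section \<open>From finite levels to the infinite product measure\<close>

text \<open>An event read off the finite set \<open>A\<close> is the disjoint union, over the
  admissible sets \<open>S\<close> of open edges, of the cylinders \<open>C S\<close>, whose
  measures are the weights in \<open>expect\<close>.\<close>

lemma perc_cylinder:
  assumes "finite A" "A \<subseteq> edges d k" "p \<in> {0..1}" "q \<in> {0..1}" "depends_on A Q"
  shows "{w \<in> space (perc d k p q). Q w} \<in> sets (perc d k p q)"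
    and "measure (perc d k p q) {w \<in> space (perc d k p q). Q w}
      = expect A (edge_prob p q) (\<lambda>w. of_bool (Q w))"
proof -
  define M where "M = (\<lambda>e. measure_pmf (bernoulli_pmf (edge_prob p q e)))"
  interpret product_prob_space M "edges d k"
    by (rule product_prob_spaceI) (simp add: M_def prob_space_measure_pmf)
  have perc: "perc d k p q = PiM (edges d k) M" by (simp add: perc_def M_def)
  let ?M = "PiM (edges d k) M"
  define C where "C = (\<lambda>S. prod_emb (edges d k) M A (\<Pi>\<^sub>E e\<in>A. {e \<in> S}))"
  define \<S> where "\<S> = {S \<in> Pow A. Q (\<lambda>e. e \<in> S)}"
  have fin: "finite \<S>" using assms by (simp add: \<S>_def)
  have C_eq: "C S = {w \<in> space ?M. \<forall>e\<in>A. w e = (e \<in> S)}" for S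
    using assms(2) unfolding C_def prod_emb_def by (auto simp: space_PiM M_def)
  have C_sets: "C S \<in> sets ?M" for S
    unfolding C_def using assms by (intro sets_PiM_I) (auto simp: M_def)
  have C_measure: "measure ?M (C S) = (\<Prod>e\<in>A. if e \<in> S then edge_prob p q e else 1 - edge_prob p q e)" for S
  proof -
    have "measure ?M (C S) = (\<Prod>e\<in>A. measure (M e) {e \<in> S})"
      unfolding C_def using assms by (intro measure_PiM_emb) (auto simp: M_def)
    also have "\<dots> = (\<Prod>e\<in>A. if e \<in> S then edge_prob p q e else 1 - edge_prob p q e)"
      using edge_prob_unit[OF assms(3,4)]
      by (intro prod.cong) (auto simp: M_def measure_pmf_single)
    finally show ?thesis .
  qed
  have Q_eq: "{w \<in> space ?M. Q w} = (\<Union>S\<in>\<S>. C S)"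
  proof (intro equalityI subsetI)
    fix w assume w: "w \<in> {w \<in> space ?M. Q w}"
    have "Q (\<lambda>e. e \<in> {e \<in> A. w e}) = Q w" by (rule depends_onD[OF assms(5)]) auto
    with w have "{e \<in> A. w e} \<in> \<S>" "w \<in> C {e \<in> A. w e}" by (auto simp: \<S>_def C_eq)
    thus "w \<in> (\<Union>S\<in>\<S>. C S)" by blast
  next
    fix w assume "w \<in> (\<Union>S\<in>\<S>. C S)"
    then obtain S where S: "S \<in> \<S>" "w \<in> C S" by blast
    hence "Q w = Q (\<lambda>e. e \<in> S)" by (intro depends_onD[OF assms(5)]) (auto simp: C_eq)
    with S show "w \<in> {w \<in> space ?M. Q w}" by (auto simp: \<S>_def C_eq)
  qed
  show "{w \<in> space (perc d k p q). Q w} \<in> sets (perc d k p q)"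
    unfolding perc Q_eq using fin C_sets by auto
  have disj: "disjoint_family_on C \<S>"
    unfolding disjoint_family_on_def
  proof (intro ballI impI)
    fix S T assume "S \<in> \<S>" "T \<in> \<S>" "S \<noteq> T"
    moreover from this have "S \<subseteq> A" "T \<subseteq> A" by (auto simp: \<S>_def)
    ultimately show "C S \<inter> C T = {}" unfolding C_eq by blast
  qed
  have "measure ?M {w \<in> space ?M. Q w} = (\<Sum>S\<in>\<S>. measure ?M (C S))"
    unfolding Q_eq using fin C_sets disj by (intro P.finite_measure_finite_Union) auto
  also have "\<dots> = (\<Sum>S\<in>Pow A. if Q (\<lambda>e. e \<in> S) then measure ?M (C S) else 0)"
    unfolding \<S>_def by (rule sum.inter_filter) (use assms(1) in simp)
  also have "\<dots> = expect A (edge_prob p q) (\<lambda>w. of_bool (Q w))"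
    unfolding expect_def C_measure by (intro sum.cong) simp_all
  finally show "measure (perc d k p q) {w \<in> space (perc d k p q). Q w}
      = expect A (edge_prob p q) (\<lambda>w. of_bool (Q w))" unfolding perc .
qed

lemma prob_space_perc: "prob_space (perc d k p q)"
  unfolding perc_def by (intro prob_space_PiM prob_space_measure_pmf)

lemma tree_reach_word: "tree_reach d k w u v \<Longrightarrow> word d u \<Longrightarrow> word d v"
  unfolding tree_reach_def
proof (induction rule: rtranclp_induct)
  case (step v v')
  have "word d [a]" if "a \<in> {1..d}" for a using that by (simp add: word_def)
  with step show ?case by (auto simp: open_step_def simp del: atLeastAtMost_iff)
qed

text \<open>The alphabet is finite, so an infinite cluster is one of unbounded depth. Long edges can
  skip levels, so the events \<open>hits\<close> need not decrease in \<open>n\<close>, and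
  percolation is their limsup.\<close>

lemma percolates_iff_hits: "percolates d k w \<longleftrightarrow> (\<forall>m. \<exists>n\<ge>m. hits d k n w)"
proof
  assume inf: "percolates d k w"
  show "\<forall>m. \<exists>n\<ge>m. hits d k n w"
  proof (rule ccontr)
    assume "\<not> (\<forall>m. \<exists>n\<ge>m. hits d k n w)"
    then obtain m where m: "\<And>n. n \<ge> m \<Longrightarrow> \<not> hits d k n w" by blast
    have "{v. tree_reach d k w [] v} \<subseteq> {xs. set xs \<subseteq> {1..d} \<and> length xs \<le> m}"
    proof
      fix v assume v: "v \<in> {v. tree_reach d k w [] v}"
      hence wv: "word d v" using tree_reach_word[of d k w "[]" v] by (simp add: word_def)
      hence "hits d k (length v) w" using v by (auto simp: hits_def level_def)
      hence "length v \<le> m" using m[of "length v"] by force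
      with wv show "v \<in> {xs. set xs \<subseteq> {1..d} \<and> length xs \<le> m}" by (simp add: word_def)
    qed
    hence "finite {v. tree_reach d k w [] v}"
      using finite_lists_length_le[of "{1..d}" m] by (auto intro: finite_subset)
    with inf show False by (simp add: percolates_def tree_reach_def)
  qed
next
  assume hits: "\<forall>m. \<exists>n\<ge>m. hits d k n w"
  show "percolates d k w"
    unfolding percolates_def
  proof
    let ?R = "{v. (open_step d k w)\<^sup>*\<^sup>* [] v}"
    assume "finite ?R"
    hence fin: "finite (length ` ?R)" by simp
    obtain n where n: "n \<ge> Suc (Max (length ` ?R))" "hits d k n w" using hits by blast
    then obtain v where "v \<in> ?R" "length v = n" by (auto simp: hits_def level_def tree_reach_def)
    hence "n \<le> Max (length ` ?R)" using fin by (intro Max_ge) auto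
    with n show False by simp
  qed
qed

context
  fixes d k :: nat and p q :: real
  assumes k: "1 \<le> k" and p: "p \<in> {0..1}" and q: "q \<in> {0..1}"
begin

interpretation prob_space "perc d k p q" by (rule prob_space_perc)

lemma hits_event:
  "{w \<in> space (perc d k p q). hits d k n w} \<in> events"
  "prob {w \<in> space (perc d k p q). hits d k n w} = level_prob d k p q n"
  using perc_cylinder[OF finite_tree_edges tree_edges_subset p q depends_on_hits[OF k]]
  by (simp_all add: level_prob_def)

text \<open>Level probabilities along multiples of \<open>n\<close> stay above \<open>c\<close>,
  hence so do the decreasing tail unions \<open>H m\<close>; continuity from above carries the bound
  to the limsup.\<close>

lemma theta_pos:
  assumes "1 \<le> d" "1 \<le> n" "1 < real d ^ n * ray k p q n"
  shows "0 < theta d k p q"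
proof -
  obtain c where c: "0 < c" "\<And>j. c \<le> level_prob d k p q (n * j)"
    by (rule level_prob_bounded_below[OF assms(1) k p q assms(3)]) (rule that)
  let ?\<Omega> = "space (perc d k p q)"
  define H where "H = (\<lambda>m. \<Union>j\<in>{m..}. {w \<in> ?\<Omega>. hits d k j w})"
  have H: "range H \<subseteq> events" using hits_event(1) by (auto simp: H_def)
  have "decseq H" unfolding H_def decseq_def by (intro allI impI UN_mono) auto
  hence lim: "(\<lambda>m. prob (H m)) \<longlonglongrightarrow> prob (\<Inter>m. H m)" by (rule finite_Lim_measure_decseq[OF H])
  have "c \<le> prob (H m)" for m
  proof -
    have "c \<le> prob {w \<in> ?\<Omega>. hits d k (n * m) w}" using c(2)[of m] hits_event(2) by simp
    also have "\<dots> \<le> prob (H m)"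
      using H assms(2) by (intro finite_measure_mono) (auto simp: H_def intro!: bexI[of _ "n * m"])
    finally show ?thesis .
  qed
  hence "c \<le> prob (\<Inter>m. H m)" by (intro LIMSEQ_le_const[OF lim]) auto
  moreover have "(\<Inter>m. H m) = {w \<in> ?\<Omega>. percolates d k w}"
    unfolding percolates_iff_hits H_def by auto
  ultimately show ?thesis using c(1) by (simp add: theta_def)
qed

lemma theta_zero:
  assumes "summable (\<lambda>n. real d ^ n * ray k p q n)"
  shows "theta d k p q = 0"
proof -
  let ?\<Omega> = "space (perc d k p q)"
  have "summable (\<lambda>n. prob {w \<in> ?\<Omega>. hits d k n w})"
    using assms by (rule summable_comparison_test')
      (use level_prob_le[OF k p q] in \<open>simp add: hits_event(2) level_prob_nonneg[OF p q]\<close>)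
  hence "AE w in perc d k p q. \<forall>\<^sub>F n in sequentially. w \<in> ?\<Omega> - {w \<in> ?\<Omega>. hits d k n w}"
    by (intro borel_cantelli_AE1 hits_event(1)) (auto simp: less_top[symmetric])
  hence ae: "AE w in perc d k p q. \<not> percolates d k w"
    by eventually_elim (auto simp: percolates_iff_hits eventually_sequentially)
  \<comment> \<open>Passing from an almost sure statement to measure 0 through
    \<open>prob_eq_0\<close> requires the event to be measurable.\<close>
  have "{w \<in> ?\<Omega>. percolates d k w} = (\<Inter>m. \<Union>n\<in>{m..}. {w \<in> ?\<Omega>. hits d k n w})"
    unfolding percolates_iff_hits by auto
  also have "\<dots> \<in> events" using hits_event(1) by auto
  finally have "{w \<in> ?\<Omega>. percolates d k w} \<in> events" .
  with ae show ?thesis by (simp add: theta_def prob_eq_0)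
qed

end

subsection \<open>The critical curve\<close>

text \<open>A condition on a single \<open>n\<close>, hence stable under small changes of the
  parameters; this openness is the source of the semicontinuity used below.\<close>

definition supercritical :: "nat \<Rightarrow> nat \<Rightarrow> real \<Rightarrow> real \<Rightarrow> bool" where
  "supercritical d k p q \<longleftrightarrow> (\<exists>n\<ge>1. 1 < real d ^ n * ray k p q n)"

definition subcritical :: "nat \<Rightarrow> nat \<Rightarrow> real \<Rightarrow> real \<Rightarrow> bool" where
  "subcritical d k p q \<longleftrightarrow> summable (\<lambda>n. real d ^ n * ray k p q n)"

lemma ex_power_scale_gt_one:
  fixes X :: real
  assumes "1 < X"
  obtains t where "0 < t" "t < 1" "1 < t ^ n * X"
proof -
  have "((\<lambda>t. t ^ n * X) \<longlongrightarrow> 1 ^ n * X) (at_left 1)"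
    by (intro tendsto_intros)
  hence "\<forall>\<^sub>F t in at_left 1. 1 < t ^ n * X"
    using assms by (intro order_tendstoD) auto
  moreover have "\<forall>\<^sub>F t in at_left 1. t \<in> {0<..<1 :: real}"
    by (rule eventually_at_leftI[of 0]) auto
  ultimately have "\<forall>\<^sub>F t in at_left 1. 0 < t \<and> t < 1 \<and> 1 < t ^ n * X"
    by eventually_elim auto
  from eventually_happens[OF this] show ?thesis using that by auto
qed

context
  fixes d k :: nat
  assumes d: "2 \<le> d" and k: "1 \<le> k"
begin

lemma d_pow: "2 \<le> real d ^ k"
proof -
  have "real d ^ 1 \<le> real d ^ k" using d k by (intro power_increasing) auto
  moreover have "2 \<le> real d ^ 1" unfolding power_one_right using d by linarith
  ultimately show ?thesis by linarith
qed

lemma subcritical_geometric: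
  assumes "p \<in> {0..1}" "q \<in> {0..1}" "0 \<le> r" "r < 1" "\<And>n. real d ^ n * ray k p q n \<le> C * r ^ n"
  shows "subcritical d k p q"
  unfolding subcritical_def
proof (rule summable_comparison_test')
  show "summable (\<lambda>n. C * r ^ n)" using assms by (intro summable_mult summable_geometric) auto
  show "norm (real d ^ n * ray k p q n) \<le> C * r ^ n" for n
    using assms(5)[of n] ray_nonneg[OF assms(1,2), of k n] by simp
qed

lemma not_supercriticalD:
  assumes "\<not> supercritical d k p q"
  shows "real d ^ n * ray k p q n \<le> 1"
proof (cases "n = 0")
  case False
  thus ?thesis using assms unfolding supercritical_def by (meson not_le less_one)
qed (use k in simp)

lemma supercritical_mono:
  assumes "supercritical d k p q" "0 \<le> p" "p \<le> p'" "p' \<le> 1" "0 \<le> q" "q \<le> q'" "q' \<le> 1"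
  shows "supercritical d k p' q'"
proof -
  obtain n where n: "1 \<le> n" "1 < real d ^ n * ray k p q n"
    using assms(1) by (auto simp: supercritical_def)
  have "real d ^ n * ray k p q n \<le> real d ^ n * ray k p' q' n"
    using assms k by (intro mult_left_mono ray_mono) auto
  with n show ?thesis unfolding supercritical_def by (intro exI[of _ n]) auto
qed

lemma subcritical_mono:
  assumes "subcritical d k p q" "p \<in> {0..1}" "0 \<le> q'" "q' \<le> q" "q \<le> 1"
  shows "subcritical d k p q'"
  using assms(1) unfolding subcritical_def
proof (rule summable_comparison_test')
  fix n
  have "ray k p q' n \<le> ray k p q n" using assms k by (intro ray_mono) auto
  thus "norm (real d ^ n * ray k p q' n) \<le> real d ^ n * ray k p q n"
    using assms ray_nonneg[of p q' k n] by (auto intro: mult_left_mono)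
qed

lemma supercritical_edge:
  assumes "p \<in> {0..1}" "q \<in> {0..1}" "1 < real d * p \<or> 1 < real d ^ k * q"
  shows "supercritical d k p q"
proof -
  have "real d ^ 1 * p \<le> real d ^ 1 * ray k p q 1"
    using ray_leap_ge[OF k assms(1,2), of False] by (intro mult_left_mono) (auto simp: leap_def)
  moreover have "real d ^ k * q \<le> real d ^ k * ray k p q k"
    using ray_leap_ge[OF k assms(1,2), of True] by (intro mult_left_mono) (auto simp: leap_def)
  moreover have "\<exists>n\<ge>1. 1 < real d ^ n * ray k p q n" if "1 < real d ^ m * ray k p q m" "1 \<le> m" for m
    using that by blast
  ultimately show ?thesis
    unfolding supercritical_def using assms(3) k by (metis less_le_trans order_refl power_one_right)
qed

text \<open>For \<open>s < 1\<close> above \<open>d p + d^k q\<close> and \<open>t^k = s\<close>, the recursion gives \<open>d^n \<pi>_n \<le> t^n\<close> by induction.\<close>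

lemma subcritical_small:
  assumes "p \<in> {0..1}" "q \<in> {0..1}" "real d * p + real d ^ k * q < 1"
  shows "subcritical d k p q"
proof -
  define u v where "u = real d * p" and "v = real d ^ k * q"
  have uv: "0 \<le> u" "0 \<le> v" "u + v < 1" using assms by (auto simp: u_def v_def)
  \<comment> \<open>The midpoint of 1 and \<open>u + v\<close>, not \<open>u + v\<close> itself: it
    stays positive when both parameters vanish, which gives \<open>t > 0\<close>.\<close>
  define s where "s = (1 + u + v) / 2"
  have s: "0 < s" "s < 1" "u + v \<le> s" using uv by (auto simp: s_def)
  define t where "t = root k s"
  have t: "0 < t" "t < 1" "t ^ k = s" using s k by (auto simp: t_def)
  have st: "s \<le> t" using t power_decreasing[of 1 k t] k by simp
  have "real d ^ n * ray k p q n \<le> t ^ n" for n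
  proof (induction n rule: less_induct)
    case (less n)
    show ?case
    proof (cases "n = 0")
      case False
      have rec: "ray k p q n \<le> p * ray k p q (n - 1) + (if k \<le> n then q * ray k p q (n - k) else 0)"
        by (rule ray_recursion) (use False k assms in auto)
      have 1: "real d ^ n * (p * ray k p q (n - 1)) \<le> u * t ^ (n - 1)"
      proof -
        have "real d ^ n * (p * ray k p q (n - 1)) = u * (real d ^ (n - 1) * ray k p q (n - 1))"
          using False by (cases n) (auto simp: u_def)
        also have "\<dots> \<le> u * t ^ (n - 1)"
          by (rule mult_left_mono[OF less uv(1)]) (use False in simp)
        finally show ?thesis .
      qed
      show ?thesis
      proof (cases "k \<le> n")
        case True
        have "real d ^ n = real d ^ k * real d ^ (n - k)" using True by (simp flip: power_add)
        hence "real d ^ n * (q * ray k p q (n - k)) = v * (real d ^ (n - k) * ray k p q (n - k))"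
          by (simp add: v_def)
        also have "\<dots> \<le> v * t ^ (n - k)"
          by (rule mult_left_mono[OF less uv(2)]) (use False k in simp)
        finally have 2: "real d ^ n * (q * ray k p q (n - k)) \<le> v * t ^ (n - k)" .
        have "t ^ (n - 1) \<le> t ^ (n - k)" using t k by (intro power_decreasing) auto
        hence 3: "u * t ^ (n - 1) \<le> u * t ^ (n - k)" using uv by (intro mult_left_mono) auto
        have "real d ^ n * ray k p q n \<le> real d ^ n * (p * ray k p q (n - 1) + q * ray k p q (n - k))"
          using rec True by (intro mult_left_mono) auto
        also have "\<dots> \<le> (u + v) * t ^ (n - k)" using 1 2 3 by (simp add: algebra_simps)
        also have "\<dots> \<le> t ^ k * t ^ (n - k)" using s t by (intro mult_right_mono) auto
        also have "\<dots> = t ^ n" using True by (simp flip: power_add)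
        finally show ?thesis .
      next
        case n: False
        have "real d ^ n * ray k p q n \<le> real d ^ n * (p * ray k p q (n - 1))"
          using rec n by (intro mult_left_mono) auto
        also note 1
        also have "u * t ^ (n - 1) \<le> t * t ^ (n - 1)" using st s uv t by (intro mult_right_mono) auto
        also have "\<dots> = t ^ n" using False by (cases n) auto
        finally show ?thesis .
      qed
    qed (use k in simp)
  qed
  thus ?thesis using assms t by (intro subcritical_geometric[where r = t and C = 1]) auto
qed

section \<open>Bounds on the critical value\<close>

lemma q_c_le:
  assumes "supercritical d k p q" "p \<in> {0..1}" "q \<in> {0..1}"
  shows "q_c d k p \<le> q"
proof -
  obtain n where n: "1 \<le> n" "1 < real d ^ n * ray k p q n"
    using assms(1) by (auto simp: supercritical_def)
  have "0 < theta d k p q" by (rule theta_pos[OF k assms(2,3) _ n]) (use d in simp)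
  hence "q \<in> {q. (p, q) \<in> perc_region d k}" using assms by (simp add: perc_region_def)
  moreover have "bdd_below {q. (p, q) \<in> perc_region d k}"
    by (rule bdd_belowI[of _ 0]) (auto simp: perc_region_def)
  ultimately show ?thesis unfolding q_c_def by (rule cInf_lower)
qed

lemma supercritical_one: "p \<in> {0..1} \<Longrightarrow> supercritical d k p 1"
  using d_pow by (intro supercritical_edge) auto

text \<open>Guards the real infimum in \<open>q_c\<close> against the empty set; q = 1 always
  qualifies because \<open>d ^ k > 1\<close>.\<close>

lemma perc_region_nonempty:
  assumes "p \<in> {0..1}"
  shows "{q. (p, q) \<in> perc_region d k} \<noteq> {}"
proof -
  obtain n where n: "1 \<le> n" "1 < real d ^ n * ray k p 1 n"
    using supercritical_one[OF assms] by (auto simp: supercritical_def)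
  have "0 < theta d k p 1" by (rule theta_pos[OF k assms _ _ n]) (use d in auto)
  hence "1 \<in> {q. (p, q) \<in> perc_region d k}" using assms by (simp add: perc_region_def)
  thus ?thesis by blast
qed

text \<open>Subcriticality passes to smaller q, so no q' below \<open>q\<close> can percolate. This
  takes the place of monotonicity of \<open>theta\<close>.\<close>

lemma q_c_ge:
  assumes "subcritical d k p q" "p \<in> {0..1}" "q \<in> {0..1}"
  shows "q \<le> q_c d k p"
  unfolding q_c_def
proof (rule cInf_greatest[OF perc_region_nonempty[OF assms(2)]])
  fix q' assume q': "q' \<in> {q. (p, q) \<in> perc_region d k}"
  hence "q' \<in> {0..1}" "theta d k p q' \<noteq> 0" by (auto simp: perc_region_def)
  hence "\<not> subcritical d k p q'" using theta_zero[OF k assms(2)] by (auto simp: subcritical_def)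
  thus "q \<le> q'" using subcritical_mono[OF assms(1,2), of q'] assms(3) \<open>q' \<in> {0..1}\<close> by force
qed

lemma q_c_nonneg: "p \<in> {0..1} \<Longrightarrow> 0 \<le> q_c d k p"
  unfolding q_c_def by (intro cInf_greatest perc_region_nonempty) (auto simp: perc_region_def)

lemma q_c_le_one: "p \<in> {0..1} \<Longrightarrow> q_c d k p \<le> 1"
  using q_c_le[OF supercritical_one] by simp

lemma q_c_upper: 
  assumes "p \<in> {0..1}"
  shows "q_c d k p \<le> 1 / real d ^ k"
proof (rule ccontr)
  assume "\<not> ?thesis"
  then obtain q where q: "1 / real d ^ k < q" "q < q_c d k p"
    using dense[of "1 / real d ^ k" "q_c d k p"] by auto
  have "0 < 1 / real d ^ k" using d by simp
  hence "0 \<le> q" using q by linarith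
  hence q01: "q \<in> {0..1}" using q q_c_le_one[OF assms] by simp
  have "1 < real d ^ k * q" using q(1) d by (simp add: field_simps)
  hence "q_c d k p \<le> q" by (intro q_c_le[OF supercritical_edge] assms q01 disjI2)
  with q show False by simp
qed

lemma q_c_less_one: "p \<in> {0..1} \<Longrightarrow> q_c d k p < 1"
proof -
  assume "p \<in> {0..1}"
  hence "q_c d k p \<le> 1 / real d ^ k" by (rule q_c_upper)
  also have "\<dots> < 1" using d_pow by (subst divide_less_eq_1_pos) linarith+
  finally show ?thesis .
qed

text \<open>Together with \<open>q_c_upper\<close> it pins the value at p = 0 to
  \<open>1 / d ^ k\<close> and controls q_c near that endpoint, where edges need not be pivotal; it
  also yields positivity for p < 1/d.\<close>

lemma q_c_lower:
  assumes "p \<in> {0..1}"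
  shows "(1 - real d * p) / real d ^ k \<le> q_c d k p"
proof (rule ccontr)
  assume "\<not> ?thesis"
  then obtain q where q: "q_c d k p < q" "q < (1 - real d * p) / real d ^ k"
    using dense[of "q_c d k p" "(1 - real d * p) / real d ^ k"] by auto
  have D: "1 \<le> real d ^ k" using d_pow by simp
  have "(1 - real d * p) / real d ^ k \<le> 1 / real d ^ k" using D assms by (intro divide_right_mono) auto
  also have "\<dots> \<le> 1" using D by (subst divide_le_eq_1_pos) linarith+
  finally have q01: "q \<in> {0..1}" using q q_c_nonneg[OF assms] by auto
  have "real d * p + real d ^ k * q < 1"
    using q(2) d by (subst (asm) pos_less_divide_eq) (auto simp: mult.commute)
  hence "q \<le> q_c d k p" by (intro q_c_ge[OF subcritical_small] assms q01)
  with q show False by simp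
qed

section \<open>Sharpness of the transition and openness of the supercritical regime\<close>

text \<open>Failure of supercriticality at \<open>q'\<close> keeps
  \<open>d ^ n * ray k p q' n\<close> bounded by 1; the strict comparison between \<open>q\<close>
  and \<open>q'\<close> supplies the geometric factor.\<close>

lemma subcritical_below:
  assumes "\<not> supercritical d k p q'" "0 < p" "p < 1" "0 \<le> q" "q < q'" "q' < 1"
  obtains r C where "0 < r" "r < 1" "\<And>n. real d ^ n * ray k p q n \<le> C * r ^ n"
proof -
  obtain r C where r: "0 < r" "r < 1" "0 < C" "\<And>n. ray k p q n \<le> C * r ^ n * ray k p q' n"
    using ray_strict_long[OF k assms(2-)] by metis
  have "real d ^ n * ray k p q n \<le> C * r ^ n" for n
  proof -
    have "real d ^ n * ray k p q n \<le> real d ^ n * (C * r ^ n * ray k p q' n)"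
      using r by (intro mult_left_mono) auto
    also have "\<dots> = C * r ^ n * (real d ^ n * ray k p q' n)" by simp
    also have "\<dots> \<le> C * r ^ n * 1" using r not_supercriticalD[OF assms(1)] by (intro mult_left_mono) auto
    finally show ?thesis by simp
  qed
  with r show ?thesis by (intro that)
qed

lemma supercritical_above:
  assumes "0 < p" "p \<le> 1" "q_c d k p < q" "q < 1"
  shows "supercritical d k p q"
proof (rule ccontr)
  assume nsup: "\<not> ?thesis"
  have p: "p \<in> {0..1}" using assms by auto
  obtain q' where q': "q_c d k p < q'" "q' < q" using dense[OF assms(3)] by blast
  have q'0: "0 \<le> q'" using q_c_nonneg[OF p] q' by simp
  \<comment> \<open>The strict comparison needs p < 1; at p = 1 the short edges alone are
    supercritical since d > 1.\<close>
  have "p \<noteq> 1" using nsup supercritical_edge[OF p, of q] assms d q' q'0 by auto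
  then obtain r C where "0 < r" "r < 1" "\<And>n. real d ^ n * ray k p q' n \<le> C * r ^ n"
    using subcritical_below[OF nsup assms(1) _ q'0 q'(2) assms(4)] assms(2) by (metis less_le)
  hence "subcritical d k p q'"
    using p q' q'0 assms by (intro subcritical_geometric) auto
  from q_c_ge[OF this p] q' q'0 assms show False by auto
qed

lemma supercritical_open_short:
  assumes "supercritical d k p q" "p \<in> {0..1}" "q \<in> {0..1}"
  obtains t where "0 < t" "t < 1" "supercritical d k (t * p) q"
proof -
  obtain n where n: "1 \<le> n" "1 < real d ^ n * ray k p q n"
    using assms(1) by (auto simp: supercritical_def)
  obtain t where t: "0 < t" "t < 1" "1 < t ^ n * (real d ^ n * ray k p q n)"
    using ex_power_scale_gt_one[OF n(2)] .
  have "real d ^ n * (t ^ n * ray k p q n) \<le> real d ^ n * ray k (t * p) q n"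
    using t by (intro mult_left_mono ray_thin_short[OF k assms(2,3)]) auto
  hence "1 < real d ^ n * ray k (t * p) q n" using t(3) by (simp add: mult_ac)
  with n t show ?thesis using that by (auto simp: supercritical_def)
qed

lemma supercritical_open_long:
  assumes "supercritical d k p q" "p \<in> {0..1}" "q \<in> {0..1}"
  obtains t where "0 < t" "t < 1" "supercritical d k p (t * q)"
proof -
  obtain n where n: "1 \<le> n" "1 < real d ^ n * ray k p q n"
    using assms(1) by (auto simp: supercritical_def)
  obtain t where t: "0 < t" "t < 1" "1 < t ^ n * (real d ^ n * ray k p q n)"
    using ex_power_scale_gt_one[OF n(2)] .
  have "real d ^ n * (t ^ n * ray k p q n) \<le> real d ^ n * ray k p (t * q) n"
    using t by (intro mult_left_mono ray_thin_long[OF k assms(2,3)]) auto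
  hence "1 < real d ^ n * ray k p (t * q) n" using t(3) by (simp add: mult_ac)
  with n t show ?thesis using that by (auto simp: supercritical_def)
qed

section \<open>Monotonicity and continuity of the critical curve\<close>

lemma q_c_antimono:
  assumes "0 \<le> p1" "p1 \<le> p2" "p2 \<le> 1"
  shows "q_c d k p2 \<le> q_c d k p1"
proof (cases "p1 = 0")
  case True
  \<comment> \<open>\<open>supercritical_above\<close> needs a positive short weight; at 0 the curve
    attains its global upper bound.\<close>
  have "q_c d k p2 \<le> 1 / real d ^ k" using assms by (intro q_c_upper) auto
  also have "\<dots> \<le> q_c d k p1" using q_c_lower[of p1] True by simp
  finally show ?thesis .
next
  case False
  show ?thesis
  proof (rule ccontr)
    assume "\<not> ?thesis"
    then obtain q where q: "q_c d k p1 < q" "q < q_c d k p2"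
      using dense[of "q_c d k p1" "q_c d k p2"] by auto
    have q01: "0 \<le> q" "q < 1" using q q_c_nonneg[of p1] q_c_less_one[of p2] assms by auto
    have sup: "supercritical d k p1 q" using False assms q q01 by (intro supercritical_above) auto
    have "supercritical d k p2 q" using assms q01 by (intro supercritical_mono[OF sup]) auto
    from q_c_le[OF this] assms q01 q show False by auto
  qed
qed

text \<open>If the curve did not drop, \<open>q0 = q_c d k p\<close> at the midpoint would be at
  most q_c at \<open>p2\<close>, so by openness \<open>(p2, q0)\<close> is not supercritical. Moving
  from \<open>p2\<close> down to \<open>p\<close> gains a factor \<open>r ^ n\<close>, and part of
  it pays for raising \<open>q0\<close> to \<open>q0 / t\<close>: then \<open>(p, q0 / t)\<close> is
  subcritical, contradicting the choice of \<open>q0\<close>.\<close>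

lemma q_c_strict:
  assumes "0 \<le> p1" "p1 < p2" "p2 \<le> 1 / real d"
  shows "q_c d k p2 < q_c d k p1"
proof (rule ccontr)
  assume neg: "\<not> q_c d k p2 < q_c d k p1"
  \<comment> \<open>The midpoint is positive even for \<open>p1 = 0\<close>, as the pivotal
    comparison requires, and lies strictly below 1/d.\<close>
  define p where "p = (p1 + p2) / 2"
  define q0 where "q0 = q_c d k p"
  have "1 / real d < 1" using d by simp
  hence p: "0 < p" "p1 < p" "p < p2" "p2 < 1" using assms by (auto simp: p_def)
  have p01: "p \<in> {0..1}" "p2 \<in> {0..1}" using p by auto
  have "q0 \<le> q_c d k p1" unfolding q0_def using p assms by (intro q_c_antimono) auto
  hence q0_le: "q0 \<le> q_c d k p2" using neg by simp
  have "real d * p < real d * p2" using p d by simp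
  also have "\<dots> \<le> 1" using assms(3) d by (simp add: field_simps)
  finally have "real d * p < 1" .
  \<comment> \<open>Positivity of \<open>q0\<close> is where the restriction to [0, 1/d] enters:
    otherwise dividing by \<open>t\<close> would not raise it.\<close>
  hence "0 < (1 - real d * p) / real d ^ k" using d by (intro divide_pos_pos) auto
  also have "\<dots> \<le> q0" unfolding q0_def using p01 by (intro q_c_lower)
  finally have q0: "0 < q0" "q0 < 1" unfolding q0_def using q_c_less_one[OF p01(1)] by auto
  have "\<not> supercritical d k p2 q0"
  proof
    assume "supercritical d k p2 q0"
    then obtain t where t: "0 < t" "t < 1" "supercritical d k p2 (t * q0)"
      using supercritical_open_long p01 q0 by (metis atLeastAtMost_iff less_imp_le)
    have "t * q0 < q0" using t q0 by simp
    moreover have "q_c d k p2 \<le> t * q0" using t p01 q0 by (intro q_c_le) (auto intro: mult_le_one)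
    ultimately show False using q0_le by simp
  qed
  note bound = not_supercriticalD[OF this]
  obtain r where r: "0 < r" "r < 1" "\<And>n. ray k p q0 n \<le> r ^ n * ray k p2 q0 n"
    using ray_strict_short[OF k p(1,3,4), of q0] q0 by (metis less_imp_le)
  \<comment> \<open>The first entry keeps \<open>q0 / t\<close> at most 1, the second leaves
    \<open>t\<close> strictly between \<open>r\<close> and 1, so that
    \<open>r / t < 1\<close>.\<close>
  define t where "t = max q0 ((1 + r) / 2)"
  have t: "r < t" "0 < t" "t < 1" "q0 / t \<le> 1" "q0 < q0 / t"
  proof -
    show "r < t" "0 < t" "t < 1" using r q0 by (auto simp: t_def less_max_iff_disj)
    thus "q0 / t \<le> 1" "q0 < q0 / t" using q0 by (auto simp: t_def field_simps)
  qed
  have "real d ^ n * ray k p (q0 / t) n \<le> 1 * (r / t) ^ n" for n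
  proof -
    have "t ^ n * ray k p (q0 / t) n \<le> ray k p q0 n"
      using ray_thin_long[OF k p01(1), of "q0 / t" t n] t q0 by simp
    also have "\<dots> \<le> r ^ n * ray k p2 q0 n" by (rule r)
    finally have "real d ^ n * (t ^ n * ray k p (q0 / t) n) \<le> real d ^ n * (r ^ n * ray k p2 q0 n)"
      by (intro mult_left_mono) auto
    also have "\<dots> = r ^ n * (real d ^ n * ray k p2 q0 n)" by simp
    also have "\<dots> \<le> r ^ n * 1" using r bound by (intro mult_left_mono) auto
    finally show ?thesis using t by (simp add: power_divide field_simps)
  qed
  hence "subcritical d k p (q0 / t)"
    using p01 t q0 r by (intro subcritical_geometric[where r = "r / t" and C = 1]) auto
  from q_c_ge[OF this p01(1)] t q0 show False by (auto simp: q0_def)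
qed

text \<open>Upper semicontinuity is openness of the supercritical regime. Lower semicontinuity is
  monotonicity on the left of \<open>p0\<close> and, on the right, exponential decay that survives a
  small increase of p.\<close>

lemma q_c_continuous: "continuous_on {0..1} (q_c d k)"
  unfolding continuous_on_def
proof (intro ballI order_tendstoI)
  fix p0 a assume p0: "p0 \<in> {0..1 :: real}" and a: "q_c d k p0 < a"
  show "\<forall>\<^sub>F p in at p0 within {0..1}. q_c d k p < a"
  \<comment> \<open>At \<open>p0 = 0\<close> the curve is maximal, and a > 1 is trivial; excluding
    both leaves a positive \<open>p0\<close> and an intermediate \<open>q < 1\<close>.\<close>
  proof (cases "p0 = 0 \<or> 1 < a")
    case True
    have "q_c d k p < a" if "p \<in> {0..1}" for p
      using True
    proof
      assume "p0 = 0"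
      thus ?thesis using q_c_antimono[of 0 p] that a by auto
    qed (use q_c_le_one[OF that] in simp)
    thus ?thesis by (auto simp: eventually_at intro!: exI[of _ 1])
  next
    case False
    obtain q where q: "q_c d k p0 < q" "q < a" using dense[OF a] by blast
    have q01: "0 \<le> q" "q < 1" using q False q_c_nonneg[OF p0] by auto
    have "supercritical d k p0 q" using p0 False q q01 by (intro supercritical_above) auto
    then obtain t where t: "0 < t" "t < 1" "supercritical d k (t * p0) q"
      by (rule supercritical_open_short) (use p0 q01 in auto)
    have "q_c d k p < a" if "p \<in> {0..1}" "dist p p0 < (1 - t) * p0" for p
    proof -
      have "t * p0 \<le> p" using that(2) by (auto simp: dist_real_def algebra_simps abs_if split: if_splits)
      hence "supercritical d k p q" using t p0 that(1) q01 by (intro supercritical_mono[OF t(3)]) auto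
      thus ?thesis using q_c_le[of p q] q q01 that(1) by auto
    qed
    moreover have "0 < (1 - t) * p0" using t p0 False by auto
    ultimately show ?thesis by (auto simp: eventually_at)
  qed
next
  fix p0 a assume p0: "p0 \<in> {0..1 :: real}" and a: "a < q_c d k p0"
  have left: "a < q_c d k p" if "p \<in> {0..1}" "p \<le> p0" for p
    using q_c_antimono[of p p0] that p0 a by auto
  have "\<exists>\<delta>>0. \<forall>p\<in>{0..1}. p0 < p \<and> p < p0 + \<delta> \<longrightarrow> a < q_c d k p"
  proof -
    consider "a < 0" | "0 \<le> a" "p0 = 0" | "0 \<le> a" "0 < p0" using p0 by fastforce
    thus ?thesis
    proof cases
      case 1
      have "a < q_c d k p" if "p \<in> {0..1}" for p using q_c_nonneg[OF that] 1 by simp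
      thus ?thesis by (intro exI[of _ 1]) auto
    next
      case 2
      have D: "0 < real d ^ k" "0 < real d" using d by auto
      have "a < 1 / real d ^ k" using a q_c_upper[OF p0] by simp
      \<comment> \<open>The radius solves (1 - d p) / d^k = a, the point where the explicit lower
        bound falls to \<open>a\<close>.\<close>
      hence ad: "0 < (1 - a * real d ^ k) / real d" using D by (simp add: field_simps)
      have "a < q_c d k p" if p: "p \<in> {0..1}" "p < (1 - a * real d ^ k) / real d" for p
      proof -
        have "a < (1 - real d * p) / real d ^ k" using p(2) D by (simp add: field_simps)
        thus ?thesis using q_c_lower[OF p(1)] by simp
      qed
      with ad 2 show ?thesis by (intro exI[of _ "(1 - a * real d ^ k) / real d"]) auto
    next
      case 3
      \<comment> \<open>Two intermediate values: \<open>q'\<close> is not supercritical at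
        \<open>p0\<close>, so decay is geometric at the smaller \<open>q\<close>, which still
        exceeds \<open>a\<close>.\<close>
      obtain q' where q': "a < q'" "q' < q_c d k p0" using dense[OF a] by blast
      obtain q where q: "a < q" "q < q'" using dense[OF q'(1)] by blast
      have q1: "q' < 1" using q' q_c_less_one[OF p0] by simp
      have nsup: "\<not> supercritical d k p0 q'"
        using q_c_le[of p0 q'] p0 q' q1 3 by auto
      have "p0 \<noteq> 1" using nsup supercritical_edge[OF p0, of q'] d q' q1 3 by auto
      hence "p0 < 1" using p0 by simp
      then obtain r C where r: "0 < r" "r < 1" "\<And>n. real d ^ n * ray k p0 q n \<le> C * r ^ n"
        using subcritical_below[OF nsup 3(2) _ _ q(2) q1] q 3 by (metis less_imp_le order_trans)
      \<comment> \<open>Thinning p back to \<open>p0\<close> costs \<open>(p0 / p) ^ n\<close>, so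
        the decay rate at p is at worst \<open>r * p / p0\<close>, below 1 exactly for p < p0 /
        r.\<close>
      have "a < q_c d k p" if p: "p \<in> {0..1}" "p0 < p" "p < p0 / r" for p
      proof -
        have q01: "q \<in> {0..1}" using q q1 3 by auto
        have "real d ^ n * ray k p q n \<le> C * (r * p / p0) ^ n" for n
        proof -
          have "(p0 / p) ^ n * ray k p q n \<le> ray k p0 q n"
            using ray_thin_short[OF k p(1) q01, of "p0 / p" n] p 3 by simp
          hence "real d ^ n * ((p0 / p) ^ n * ray k p q n) \<le> real d ^ n * ray k p0 q n"
            by (intro mult_left_mono) auto
          also have "\<dots> \<le> C * r ^ n" by (rule r)
          finally show ?thesis using p 3 by (simp add: power_divide power_mult_distrib field_simps)
        qed
        moreover have "r * p / p0 < 1" "0 \<le> r * p / p0" using p 3 r by (auto simp: field_simps)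
        ultimately have "subcritical d k p q" using p(1) q01 by (intro subcritical_geometric) auto
        from q_c_ge[OF this p(1) q01] q show ?thesis by simp
      qed
      moreover have "0 < p0 / r - p0" using r 3 by (simp add: field_simps)
      ultimately show ?thesis by (intro exI[of _ "p0 / r - p0"]) auto
    qed
  qed
  then obtain \<delta> where \<delta>: "0 < \<delta>" "\<And>p. p \<in> {0..1} \<Longrightarrow> p0 < p \<Longrightarrow> p < p0 + \<delta> \<Longrightarrow> a < q_c d k p" by blast
  have "a < q_c d k p" if "p \<in> {0..1}" "dist p p0 < \<delta>" for p
    using left[of p] \<delta>(2)[of p] that by (cases "p \<le> p0") (auto simp: dist_real_def)
  with \<delta>(1) show "\<forall>\<^sub>F p in at p0 within {0..1}. a < q_c d k p"
    by (auto simp: eventually_at)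
qed

end

theorem theorem2:
  fixes d k :: nat
  assumes "d \<ge> 2" and "k \<ge> 1"
  shows "continuous_on {0..1} (q_c d k)
    \<and> (\<forall>p1 p2. 0 \<le> p1 \<and> p1 < p2 \<and> p2 \<le> 1 / real d \<longrightarrow> q_c d k p2 < q_c d k p1)"
  using q_c_continuous[OF assms] q_c_strict[OF assms] by blast

end
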